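(* Let $\Phi$ be a (possibly reducible) finite crystallographic root system with irreducible components $\Phi_1,\dots,\Phi_k$, let $F$ be a facet of the root polytope $\mathcal P_\Phi$, and set $F_i=F\cap\mathbb E_i$, where $\mathbb E_i=\mathrm{Span}(\Phi_i)$. Then $F_i\ne\emptyset$ and $\dim F_i=\dim\mathbb E_i-1$ for all $i\in\{1,\dots,k\}$. In particular, $F$ is standard if and only if $F_i$ is a standard facet of $\mathcal P_i$ for all $i\in\{1,\dots,k\}$. In this case, for all $i\in\{1,\dots,k\}$, the set $\Pi_i(F)$ is a singleton containing a $\widehat\Pi_i$-extremal root $\alpha_i\in\Pi_i$, hence $o_i(F)=o_{\alpha_i}$, and the supporting hyperplane of $F$ is $$\{x\in\mathbb E:(x,o_{\alpha_1}+\dots+o_{\alpha_k})=1\}.$$ Conversely, for each $k$-tuple $(\alpha_1,\dots,\alpha_k)\in\Pi_1\times\dots\times\Pi_k$ such that $\alpha_i$ is $\widehat\Pi_i$-extremal for all $i\in\{1,\dots,k\}$, the hyperplane $\{x\in\mathbb E:(x,o_{\alpha_1}+\dots+o_{\alpha_k})=1\}$ supports a standard facet of $\mathcal P_\Phi$.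
   Context: $\Phi$ is a finite reduced crystallographic root system in $\mathbb E=\mathrm{Span}_{\mathbb R}\Phi$ with (Weyl-group-invariant) positive definite form $(\cdot,\cdot)$, used to identify $\mathbb E$ with its dual; $\Pi$ is a set of simple roots, $\{\check\omega_\alpha:\alpha\in\Pi\}$ is the basis of $\mathbb E$ dual to $\Pi$ (fundamental co-weights), $\mathcal C=\{x\in\mathbb E:(x,\alpha)\ge0\ \forall\alpha\in\Pi\}$. The root polytope of a root system is the convex hull of its roots. Let $\Pi_i=\Pi\cap\Phi_i$, $\mathcal C_i=\mathcal C\cap\mathbb E_i$, $\mathcal P_i=\mathcal P_\Phi\cap\mathbb E_i$ the root polytope of $\Phi_i$, $\theta_i=\sum_{\alpha\in\Pi_i}m_\alpha\alpha$ the highest root of $\Phi_i$, and $o_\alpha=\check\omega_\alpha/m_\alpha$ for $\alpha\in\Pi_i$. A face of $\mathcal P_\Phi$ (resp. $\mathcal P_i$) is standard if either its relative interior meets $\mathcal C$ (resp. $\mathcal C_i$), or it is empty. A subset $I\subseteq\Pi_i$ is $\widehat\Pi_i$-extremal if removing the vertices in $I$ from the extended Dynkin diagram of $\Phi_i$ (vertices: $\Pi_i$ and the affine vertex) leaves a connected graph; a root $\alpha\in\Pi_i$ is $\widehat\Pi_i$-extremal if $\{\alpha\}$ is. For a standard face $F\neq\mathcal P_\Phi$ with $F_i\ne\emptyset$, it is known that there is a unique (nonempty) $\widehat\Pi_i$-extremal subset $\Pi_i(F)$ of $\Pi_i$ such that $F_i=\{x\in\mathcal P_i:(x,o_\alpha)=1\text{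 for all }\alpha\in\Pi_i(F)\}$, and $o_i(F)=\frac{1}{|\Pi_i(F)|}\sum_{\alpha\in\Pi_i(F)}o_\alpha$. *)

theory Defs
  imports "HOL-Analysis.Analysis"
begin

text \<open>
  The space \<open>\<E>\<close> is the span of the roots inside an arbitrary Euclidean space, and the invariant
  form is the ambient inner product: its invariance under the Weyl group says that the reflections
  of the root system are the orthogonal ones.  The simple roots, usually called \<open>\<Pi>\<close>, are denoted by
  \<open>\<Delta>\<close>, since \<open>\<Pi>\<close> is a binder in the library.
\<close>

definition root_reflection :: "'a::euclidean_space \<Rightarrow> 'a \<Rightarrow> 'a" where
  "root_reflection \<alpha> x = x - (2 * (x \<bullet> \<alpha>) / (\<alpha> \<bullet> \<alpha>)) *\<^sub>R \<alpha>"

text \<open>Reduced crystallographic root systems, of rank at least one.\<close>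

definition root_system :: "'a::euclidean_space set \<Rightarrow> bool" where
  "root_system \<Phi> \<longleftrightarrow>
     finite \<Phi> \<and> \<Phi> \<noteq> {} \<and> 0 \<notin> \<Phi> \<and>
     (\<forall>\<alpha>\<in>\<Phi>. root_reflection \<alpha> ` \<Phi> = \<Phi>) \<and>
     (\<forall>\<alpha>\<in>\<Phi>. \<forall>\<beta>\<in>\<Phi>. 2 * (\<beta> \<bullet> \<alpha>) / (\<alpha> \<bullet> \<alpha>) \<in> \<int>) \<and>
     (\<forall>\<alpha>\<in>\<Phi>. \<forall>c. c *\<^sub>R \<alpha> \<in> \<Phi> \<longrightarrow> c = 1 \<or> c = -1)"

definition irreducible_root_system :: "'a::euclidean_space set \<Rightarrow> bool" where
  "irreducible_root_system \<Phi> \<longleftrightarrow>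
     root_system \<Phi> \<and>
     \<not> (\<exists>A B. A \<noteq> {} \<and> B \<noteq> {} \<and> A \<inter> B = {} \<and> A \<union> B = \<Phi> \<and> (\<forall>\<alpha>\<in>A. \<forall>\<beta>\<in>B. \<alpha> \<bullet> \<beta> = 0))"

definition irreducible_components :: "'a::euclidean_space set \<Rightarrow> 'a set set" where
  "irreducible_components \<Phi> =
     {\<Psi>. \<Psi> \<subseteq> \<Phi> \<and> irreducible_root_system \<Psi> \<and> (\<forall>\<alpha>\<in>\<Psi>. \<forall>\<beta>\<in>\<Phi> - \<Psi>. \<alpha> \<bullet> \<beta> = 0)}"

definition simple_roots :: "'a::euclidean_space set \<Rightarrow> 'a set \<Rightarrow> bool" where
  "simple_roots \<Phi> \<Delta> \<longleftrightarrow>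
     \<Delta> \<subseteq> \<Phi> \<and> independent \<Delta> \<and> span \<Delta> = span \<Phi> \<and>
     (\<forall>\<beta>\<in>\<Phi>. (\<forall>\<alpha>\<in>\<Delta>. representation \<Delta> \<beta> \<alpha> \<in> \<nat>) \<or> (\<forall>\<alpha>\<in>\<Delta>. - representation \<Delta> \<beta> \<alpha> \<in> \<nat>))"

definition coweight :: "'a::euclidean_space set \<Rightarrow> 'a \<Rightarrow> 'a" where
  "coweight \<Delta> \<alpha> = (THE w. w \<in> span \<Delta> \<and> (\<forall>\<beta>\<in>\<Delta>. w \<bullet> \<beta> = (if \<beta> = \<alpha> then 1 else 0)))"

definition fundamental_chamber :: "'a::euclidean_space set \<Rightarrow> 'a set \<Rightarrow> 'a set" where
  "fundamental_chamber \<Phi> \<Delta> = {x \<in> span \<Phi>. \<forall>\<alpha>\<in>\<Delta>. x \<bullet> \<alpha> \<ge> 0}"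

definition root_polytope :: "'a::euclidean_space set \<Rightarrow> 'a set" where
  "root_polytope \<Phi> = convex hull \<Phi>"

text \<open>
  In the following, \<open>\<Phi>\<close> is the whole root system, \<open>\<Delta>\<close> its simple roots and \<open>\<Psi>\<close> an irreducible
  component (\<open>\<Phi>\<^sub>i\<close> in the usual notation), with \<open>\<Delta> \<inter> \<Psi>\<close> as its simple roots.
\<close>

definition component_polytope :: "'a::euclidean_space set \<Rightarrow> 'a set \<Rightarrow> 'a set" where
  "component_polytope \<Phi> \<Psi> = root_polytope \<Phi> \<inter> span \<Psi>"

lemma component_polytope_eq_root_polytope:
  assumes "\<Psi> \<in> irreducible_components \<Phi>"
  shows "component_polytope \<Phi> \<Psi> = root_polytope \<Psi>"
proof
  have sub: "\<Psi> \<subseteq> \<Phi>" and irr: "irreducible_root_system \<Psi>"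
    and orth: "\<forall>\<alpha>\<in>\<Psi>. \<forall>\<beta>\<in>\<Phi> - \<Psi>. \<alpha> \<bullet> \<beta> = 0"
    using assms by (auto simp: irreducible_components_def)
  have rs: "root_system \<Psi>" using irr by (simp add: irreducible_root_system_def)
  show "root_polytope \<Psi> \<subseteq> component_polytope \<Phi> \<Psi>"
    unfolding component_polytope_def root_polytope_def
    using hull_mono[OF sub] convex_hull_subset_span by blast
  obtain \<alpha> where a: "\<alpha> \<in> \<Psi>" using rs by (auto simp: root_system_def)
  have "root_reflection \<alpha> \<alpha> = - \<alpha>"
    using a rs by (auto simp: root_reflection_def root_system_def scaleR_2)
  then have ma: "- \<alpha> \<in> \<Psi>" using a rs unfolding root_system_def by (metis imageI)
  have "midpoint \<alpha> (- \<alpha>) \<in> convex hull \<Psi>"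
    using a ma convex_convex_hull[of \<Psi>] hull_inc[of _ \<Psi> convex]
    by (metis convex_contains_segment midpoint_in_closed_segment subsetD)
  then have zero: "0 \<in> convex hull \<Psi>" by (simp add: midpoint_def)
  show "component_polytope \<Phi> \<Psi> \<subseteq> root_polytope \<Psi>"
  proof
    fix x assume "x \<in> component_polytope \<Phi> \<Psi>"
    then have x: "x \<in> convex hull \<Phi>" "x \<in> span \<Psi>"
      by (auto simp: component_polytope_def root_polytope_def)
    have cvx: "convex {u + v | u v. u \<in> convex hull \<Psi> \<and> v \<in> span (\<Phi> - \<Psi>)}"
      using convex_sums[OF convex_convex_hull[of \<Psi>] subspace_imp_convex[OF subspace_span[of "\<Phi> - \<Psi>"]]]
      by (rule back_subst[of convex]) blast
    have "\<Phi> \<subseteq> {u + v | u v. u \<in> convex hull \<Psi> \<and> v \<in> span (\<Phi> - \<Psi>)}"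
    proof
      fix y assume y: "y \<in> \<Phi>"
      show "y \<in> {u + v | u v. u \<in> convex hull \<Psi> \<and> v \<in> span (\<Phi> - \<Psi>)}"
      proof (cases "y \<in> \<Psi>")
        case True
        then have "y = y + 0 \<and> y \<in> convex hull \<Psi> \<and> 0 \<in> span (\<Phi> - \<Psi>)"
          by (simp add: hull_inc span_zero)
        then show ?thesis by blast
      next
        case False
        then have "y = 0 + y \<and> 0 \<in> convex hull \<Psi> \<and> y \<in> span (\<Phi> - \<Psi>)"
          using y zero by (simp add: span_base)
        then show ?thesis by blast
      qed
    qed
    then have "convex hull \<Phi> \<subseteq> {u + v | u v. u \<in> convex hull \<Psi> \<and> v \<in> span (\<Phi> - \<Psi>)}"
      using cvx by (rule hull_minimal)
    then obtain u v where uv: "x = u + v" "u \<in> convex hull \<Psi>" "v \<in> span (\<Phi> - \<Psi>)"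
      using x(1) by blast
    have "u \<in> span \<Psi>" using uv(2) convex_hull_subset_span by blast
    then have vi: "v \<in> span \<Psi>" using uv(1) x(2) by (metis add_diff_cancel_left' span_diff)
    have "orthogonal v v"
    proof (rule orthogonal_to_span[OF vi])
      fix w assume w: "w \<in> \<Psi>"
      have "orthogonal w v"
        by (rule orthogonal_to_span[OF uv(3)]) (use w orth in \<open>auto simp: orthogonal_def\<close>)
      then show "orthogonal v w" by (simp add: orthogonal_commute)
    qed
    then have "v = 0" by (simp add: orthogonal_self)
    then show "x \<in> root_polytope \<Psi>" using uv by (simp add: root_polytope_def)
  qed
qed

definition component_chamber :: "'a::euclidean_space set \<Rightarrow> 'a set \<Rightarrow> 'a set \<Rightarrow> 'a set" where
  "component_chamber \<Phi> \<Delta> \<Psi> = fundamental_chamber \<Phi> \<Delta> \<inter> span \<Psi>"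

definition highest_root :: "'a::euclidean_space set \<Rightarrow> 'a set \<Rightarrow> 'a" where
  "highest_root \<Delta> \<Psi> =
     (THE \<theta>. \<theta> \<in> \<Psi> \<and>
        (\<forall>\<beta>\<in>\<Psi>. \<forall>\<alpha>\<in>\<Delta> \<inter> \<Psi>. representation (\<Delta> \<inter> \<Psi>) \<beta> \<alpha> \<le> representation (\<Delta> \<inter> \<Psi>) \<theta> \<alpha>))"

definition highest_root_coeff :: "'a::euclidean_space set \<Rightarrow> 'a set \<Rightarrow> 'a \<Rightarrow> real" where
  "highest_root_coeff \<Delta> \<Psi> \<alpha> = representation (\<Delta> \<inter> \<Psi>) (highest_root \<Delta> \<Psi>) \<alpha>"

definition scaled_coweight :: "'a::euclidean_space set \<Rightarrow> 'a set \<Rightarrow> 'a \<Rightarrow> 'a" where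
  "scaled_coweight \<Delta> \<Psi> \<alpha> = (1 / highest_root_coeff \<Delta> \<Psi> \<alpha>) *\<^sub>R coweight \<Delta> \<alpha>"

text \<open>
  The affine vertex of the extended Dynkin diagram is the negative of the highest root. Only
  connectedness is used, so the multiplicities and orientations of the bonds are not recorded.
\<close>

definition extended_simple_roots :: "'a::euclidean_space set \<Rightarrow> 'a set \<Rightarrow> 'a set" where
  "extended_simple_roots \<Delta> \<Psi> = insert (- highest_root \<Delta> \<Psi>) (\<Delta> \<inter> \<Psi>)"

definition dynkin_edges :: "'a::euclidean_space set \<Rightarrow> ('a \<times> 'a) set" where
  "dynkin_edges V = {(u, v). u \<in> V \<and> v \<in> V \<and> u \<noteq> v \<and> u \<bullet> v \<noteq> 0}"

definition dynkin_connected :: "'a::euclidean_space set \<Rightarrow> bool" where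
  "dynkin_connected V \<longleftrightarrow> V \<noteq> {} \<and> (\<forall>u\<in>V. \<forall>v\<in>V. (u, v) \<in> (dynkin_edges V)\<^sup>*)"

definition extremal_subset :: "'a::euclidean_space set \<Rightarrow> 'a set \<Rightarrow> 'a set \<Rightarrow> bool" where
  "extremal_subset \<Delta> \<Psi> I \<longleftrightarrow>
     I \<subseteq> \<Delta> \<inter> \<Psi> \<and> dynkin_connected (extended_simple_roots \<Delta> \<Psi> - I)"

definition extremal_root :: "'a::euclidean_space set \<Rightarrow> 'a set \<Rightarrow> 'a \<Rightarrow> bool" where
  "extremal_root \<Delta> \<Psi> \<alpha> \<longleftrightarrow> \<alpha> \<in> \<Delta> \<inter> \<Psi> \<and> extremal_subset \<Delta> \<Psi> {\<alpha>}"

definition standard_face :: "'a::euclidean_space set \<Rightarrow> 'a set \<Rightarrow> 'a set \<Rightarrow> bool" where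
  "standard_face P C F \<longleftrightarrow> F face_of P \<and> (F = {} \<or> rel_interior F \<inter> C \<noteq> {})"

definition standard_facet :: "'a::euclidean_space set \<Rightarrow> 'a set \<Rightarrow> 'a set \<Rightarrow> bool" where
  "standard_facet P C F \<longleftrightarrow> F facet_of P \<and> standard_face P C F"

text \<open>The set \<open>\<Delta>\<^sub>i(F)\<close> and the vector \<open>o\<^sub>i(F)\<close> attached to a standard face \<open>F\<close>.\<close>

definition face_simple_roots ::
    "'a::euclidean_space set \<Rightarrow> 'a set \<Rightarrow> 'a set \<Rightarrow> 'a set \<Rightarrow> 'a set" where
  "face_simple_roots \<Phi> \<Delta> \<Psi> F =
     (THE I. I \<noteq> {} \<and> extremal_subset \<Delta> \<Psi> I \<and>
        F \<inter> span \<Psi> =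
          {x \<in> component_polytope \<Phi> \<Psi>. \<forall>\<alpha>\<in>I. x \<bullet> scaled_coweight \<Delta> \<Psi> \<alpha> = 1})"

definition face_barycenter ::
    "'a::euclidean_space set \<Rightarrow> 'a set \<Rightarrow> 'a set \<Rightarrow> 'a set \<Rightarrow> 'a" where
  "face_barycenter \<Phi> \<Delta> \<Psi> F =
     (1 / real (card (face_simple_roots \<Phi> \<Delta> \<Psi> F))) *\<^sub>R
       (\<Sum>\<alpha>\<in>face_simple_roots \<Phi> \<Delta> \<Psi> F. scaled_coweight \<Delta> \<Psi> \<alpha>)"

text \<open>\<open>H\<close> is a hyperplane of the subspace \<open>E\<close> that supports \<open>P\<close> and meets it exactly in \<open>F\<close>.\<close>

definition supporting_hyperplane ::
    "'a::euclidean_space set \<Rightarrow> 'a set \<Rightarrow> 'a set \<Rightarrow> 'a set \<Rightarrow> bool" where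
  "supporting_hyperplane E P F H \<longleftrightarrow>
     (\<exists>v c. v \<in> E \<and> v \<noteq> 0 \<and> H = {x \<in> E. x \<bullet> v = c} \<and> (\<forall>x\<in>P. x \<bullet> v \<le> c) \<and> F = P \<inter> H)"

end

(*
  With 0 in the relative interior, a facet is {x in P. (x, v) = 1} for a unique v with (b, v) \<le> 1 on all
  roots b and with the roots satisfying (b, v) = 1 spanning the whole space (a "facet normal").
  Since distinct components are orthogonal, v is a facet normal of \<Phi> iff each of its projections is a
  facet normal of the corresponding component, and the facet is standard iff v is dominant: reflecting
  a root b of the facet in a simple root a gives (b, a)(a, v) \<ge> 0, so when v is dominant the barycentre
  of these roots is dominant too.

  In an irreducible component, a dominant facet normal is a convex combination of the vectors o_a,
  because the highest root maximises it; as the facet spans, the combination has a single term. Finally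
  o_a is a facet normal iff a is extremal. If removing a leaves the extended diagram connected, the
  span of the roots with (b, o_a) = 1 contains the highest root and is stable under the other simple
  reflections, so it absorbs the simple roots one edge at a time. If instead B is a part separated
  from the affine vertex, all these roots have maximal coefficients on B, hence also satisfy
  (b, o_c) = 1 for c in B and cannot span.
*)
theory Submission
  imports Defs
begin


subsection \<open>Roots and reflections\<close>

text \<open>The component polytopes lie in mutually orthogonal subspaces and all contain 0, so the
  whole polytope is their free sum and its polar is the product of their polars. Facet normals are
  the vertices of the polar, and the vertices of a product are the tuples of vertices: this is why
  no facet can miss a component and why the component normals simply add up. Dominance splits in the
  same way, because every simple root belongs to a single component. The factor 1/m_a in o_a is
  forced: among the roots the coefficient at a is largest at the highest root, and the factor
  normalises this maximum to 1. Coweights, highest root and \<open>face_simple_roots\<close> are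
  definite descriptions, so existence and uniqueness have to be proved before any of them can be
  used. For the highest root this needs the irreducibility of the component to be carried over to
  its simple roots, hence the study of supports of roots.\<close>

lemma root_system_finite: "root_system \<Phi> \<Longrightarrow> finite \<Phi>"
  and root_system_nonempty: "root_system \<Phi> \<Longrightarrow> \<Phi> \<noteq> {}"
  and root_system_nonzero: "root_system \<Phi> \<Longrightarrow> 0 \<notin> \<Phi>"
  by (simp_all add: root_system_def)

lemma root_reflection_in:
  assumes "root_system \<Phi>" "\<alpha> \<in> \<Phi>" "\<beta> \<in> \<Phi>"
  shows "root_reflection \<alpha> \<beta> \<in> \<Phi>"
  using assms unfolding root_system_def by blast

lemma root_reflection_self: "\<alpha> \<noteq> 0 \<Longrightarrow> root_reflection \<alpha> \<alpha> = - \<alpha>"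
  by (simp add: root_reflection_def scaleR_2)

lemma root_uminus_in:
  assumes "root_system \<Phi>" "\<alpha> \<in> \<Phi>"
  shows "- \<alpha> \<in> \<Phi>"
proof -
  have "\<alpha> \<noteq> 0" using root_system_nonzero[OF assms(1)] assms(2) by blast
  then show ?thesis using root_reflection_in[OF assms(1,2,2)] by (simp add: root_reflection_self)
qed

lemma root_reflection_inner:
  "root_reflection \<alpha> x \<bullet> y = x \<bullet> y - 2 * (x \<bullet> \<alpha>) / (\<alpha> \<bullet> \<alpha>) * (\<alpha> \<bullet> y)"
  by (simp add: root_reflection_def inner_diff_left)

lemma linear_root_reflection: "linear (root_reflection \<alpha>)"
proof (rule linearI)
  show "root_reflection \<alpha> (x + y) = root_reflection \<alpha> x + root_reflection \<alpha> y" for x y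
    by (simp add: root_reflection_def inner_add_left distrib_left add_divide_distrib scaleR_left_distrib)
  show "root_reflection \<alpha> (c *\<^sub>R x) = c *\<^sub>R root_reflection \<alpha> x" for c x
    by (simp add: root_reflection_def scaleR_right_diff_distrib mult_ac)
qed

text \<open>The two Cartan integers \<open>p\<close> and \<open>q\<close> are positive and their
  product is 4 times the squared cosine of the angle. It is below 4, since equality in
  Cauchy-Schwarz makes the roots proportional, hence equal in a reduced system. So one of the
  integers is 1, and the corresponding reflection subtracts one root from the other.\<close>

lemma root_diff_in:
  assumes rs: "root_system \<Phi>" and a: "\<alpha> \<in> \<Phi>" and b: "\<beta> \<in> \<Phi>"
    and ne: "\<alpha> \<noteq> \<beta>" and pos: "\<alpha> \<bullet> \<beta> > 0"
  shows "\<alpha> - \<beta> \<in> \<Phi>"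
proof -
  define p where "p = 2 * (\<alpha> \<bullet> \<beta>) / (\<beta> \<bullet> \<beta>)"
  define q where "q = 2 * (\<alpha> \<bullet> \<beta>) / (\<alpha> \<bullet> \<alpha>)"
  have nz: "\<alpha> \<noteq> 0" "\<beta> \<noteq> 0" using root_system_nonzero[OF rs] a b by auto
  then have aa: "\<alpha> \<bullet> \<alpha> > 0" "\<beta> \<bullet> \<beta> > 0" by simp_all
  have "p \<in> \<int>" "q \<in> \<int>"
    using rs a b unfolding root_system_def p_def q_def by (auto simp: inner_commute)
  then obtain i j where ij: "p = of_int i" "q = of_int j" by (auto elim!: Ints_cases)
  have "p > 0" "q > 0" using pos aa by (simp_all add: p_def q_def)
  then have ij0: "i > 0" "j > 0" using ij by auto
  have strict: "(\<alpha> \<bullet> \<beta>)\<^sup>2 < (\<alpha> \<bullet> \<alpha>) * (\<beta> \<bullet> \<beta>)"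
  proof (rule ccontr)
    assume "\<not> ?thesis"
    then have "(\<alpha> \<bullet> \<beta>)\<^sup>2 = (\<alpha> \<bullet> \<alpha>) * (\<beta> \<bullet> \<beta>)"
      using Cauchy_Schwarz_ineq[of \<alpha> \<beta>] by simp
    \<comment> \<open>This is the squared length of the part of \<alpha> orthogonal to
      \<beta>.\<close>
    then have "(\<alpha> - ((\<alpha> \<bullet> \<beta>) / (\<beta> \<bullet> \<beta>)) *\<^sub>R \<beta>) \<bullet> (\<alpha> - ((\<alpha> \<bullet> \<beta>) / (\<beta> \<bullet> \<beta>)) *\<^sub>R \<beta>) = 0"
      using aa by (simp add: inner_diff_left inner_diff_right inner_commute power2_eq_square field_simps)
    then have e: "\<alpha> = ((\<alpha> \<bullet> \<beta>) / (\<beta> \<bullet> \<beta>)) *\<^sub>R \<beta>" by simp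
    then have "((\<alpha> \<bullet> \<beta>) / (\<beta> \<bullet> \<beta>)) *\<^sub>R \<beta> \<in> \<Phi>" using a by metis
    then have "(\<alpha> \<bullet> \<beta>) / (\<beta> \<bullet> \<beta>) = 1 \<or> (\<alpha> \<bullet> \<beta>) / (\<beta> \<bullet> \<beta>) = -1"
      using rs b unfolding root_system_def by blast
    moreover have "(\<alpha> \<bullet> \<beta>) / (\<beta> \<bullet> \<beta>) > 0" using pos aa by simp
    ultimately have "(\<alpha> \<bullet> \<beta>) / (\<beta> \<bullet> \<beta>) = 1" by linarith
    then show False using e ne by (metis scaleR_one)
  qed
  have "p * q = 4 * (\<alpha> \<bullet> \<beta>)\<^sup>2 / ((\<alpha> \<bullet> \<alpha>) * (\<beta> \<bullet> \<beta>))"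
    by (simp add: p_def q_def power2_eq_square)
  also have "\<dots> < 4" using strict aa by (simp add: divide_simps)
  finally have "i * j < 4" using ij by (metis of_int_mult of_int_less_numeral_iff)
  have "i = 1 \<or> j = 1"
  proof (rule ccontr)
    assume "\<not> ?thesis"
    then have "i \<ge> 2" "j \<ge> 2" using ij0 by auto
    then have "2 * 2 \<le> i * j" by (intro mult_mono) auto
    then show False using \<open>i * j < 4\<close> by simp
  qed
  then show ?thesis
  proof
    assume "i = 1"
    then have "root_reflection \<beta> \<alpha> = \<alpha> - \<beta>"
      using ij by (simp add: root_reflection_def p_def[symmetric])
    then show ?thesis using root_reflection_in[OF rs b a] by simp
  next
    assume "j = 1"
    then have "root_reflection \<alpha> \<beta> = \<beta> - \<alpha>"
      using ij by (simp add: root_reflection_def inner_commute[of \<beta> \<alpha>] q_def[symmetric])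
    then have "\<beta> - \<alpha> \<in> \<Phi>" using root_reflection_in[OF rs a b] by simp
    then show ?thesis using root_uminus_in[OF rs] by fastforce
  qed
qed

section \<open>Orthogonality and spans\<close>

lemma span_inner_zero_imp_zero:
  assumes "x \<in> span S" "\<And>y. y \<in> S \<Longrightarrow> x \<bullet> y = 0"
  shows "x = 0"
proof -
  have "orthogonal x x"
    by (rule orthogonal_to_span[OF assms(1)]) (simp add: orthogonal_def assms(2))
  then show ?thesis by (simp add: orthogonal_self)
qed

lemma span_inner_eqI:
  assumes "x \<in> span S" "z \<in> span S" "\<And>y. y \<in> S \<Longrightarrow> y \<bullet> x = y \<bullet> z"
  shows "x = z"
proof -
  have "x - z = 0"
    by (rule span_inner_zero_imp_zero[of _ S])
       (simp_all add: assms span_diff inner_commute[of "x - z"] inner_diff_right)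
  then show ?thesis by simp
qed

lemma span_inner_orthogonal:
  assumes "x \<in> span A" "y \<in> span B" "\<And>a b. a \<in> A \<Longrightarrow> b \<in> B \<Longrightarrow> a \<bullet> b = 0"
  shows "x \<bullet> y = 0"
proof -
  have "orthogonal y a" if "a \<in> A" for a
  proof -
    have "orthogonal a y"
      by (rule orthogonal_to_span[OF assms(2)]) (simp add: orthogonal_def assms(3) that)
    then show ?thesis by (simp add: orthogonal_commute)
  qed
  then have "orthogonal y x" using orthogonal_to_span[OF assms(1), of y] by blast
  then show ?thesis by (simp add: orthogonal_def inner_commute)
qed

text \<open>The part of \<open>x\<close> along \<open>B\<close> is a difference of two vectors of
  \<open>span S\<close>, hence orthogonal to itself, hence zero. Applied both to the roots of a
  facet and to the simple roots, to discard what lies outside a component.\<close>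

lemma orthogonal_component_span:
  assumes x: "x \<in> span (A \<union> B)" and S: "x \<in> span S" and "A \<subseteq> S"
    and orth: "\<And>s b. s \<in> S \<Longrightarrow> b \<in> B \<Longrightarrow> s \<bullet> b = 0"
  shows "x \<in> span A"
proof -
  obtain a b where ab: "x = a + b" "a \<in> span A" "b \<in> span B"
    using x by (auto simp: span_Un)
  have "b = x - a" using ab by simp
  then have "b \<in> span S" using S ab(2) span_mono[OF \<open>A \<subseteq> S\<close>] by (auto intro: span_diff)
  then have "b \<bullet> b = 0" using span_inner_orthogonal[OF _ ab(3) orth] by blast
  then show ?thesis using ab by simp
qed

subsection \<open>Simple roots and fundamental coweights\<close>

locale based_root_system =
  fixes \<Phi> \<Delta> :: "'a::euclidean_space set"
  assumes root_system: "root_system \<Phi>" and simple_roots: "simple_roots \<Phi> \<Delta>"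
begin

abbreviation \<omega> :: "'a \<Rightarrow> 'a" where "\<omega> \<equiv> coweight \<Delta>"

lemma simple_subset: "\<Delta> \<subseteq> \<Phi>" and simple_independent: "independent \<Delta>"
  and simple_span: "span \<Delta> = span \<Phi>"
  using simple_roots by (auto simp: simple_roots_def)

lemma finite_simple: "finite \<Delta>"
  using simple_independent by (rule independent_imp_finite)

lemma simple_in: "\<alpha> \<in> \<Delta> \<Longrightarrow> \<alpha> \<in> \<Phi>"
  using simple_subset by blast

lemma simple_nonzero: "\<alpha> \<in> \<Delta> \<Longrightarrow> \<alpha> \<noteq> 0"
  using simple_in root_system_nonzero[OF root_system] by blast

lemma root_in_span: "\<beta> \<in> \<Phi> \<Longrightarrow> \<beta> \<in> span \<Delta>"
  by (simp add: simple_span span_base)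

lemma coweight_ex1:
  "\<exists>!w. w \<in> span \<Delta> \<and> (\<forall>\<beta>\<in>\<Delta>. w \<bullet> \<beta> = (if \<beta> = \<alpha> then 1 else 0))"
proof (rule ex_ex1I)
  obtain f :: "'a \<Rightarrow> real" where f: "linear f" "\<forall>\<beta>\<in>\<Delta>. f \<beta> = (if \<beta> = \<alpha> then 1 else 0)"
    using linear_independent_extend[OF simple_independent, of "\<lambda>\<beta>. if \<beta> = \<alpha> then 1 else 0"] by metis
  \<comment> \<open>The vector representing \<open>f\<close> may leave \<open>span \<Delta>\<close>,
    which can be smaller than the ambient space; its projection has the same inner products with the
    simple roots.\<close>
  obtain w z where wz: "w \<in> span \<Delta>" "\<And>y. y \<in> span \<Delta> \<Longrightarrow> orthogonal z y" "adjoint f 1 = w + z"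
    by (rule orthogonal_subspace_decomp_exists[of \<Delta> "adjoint f 1"]) metis
  have "w \<bullet> \<beta> = f \<beta>" if "\<beta> \<in> \<Delta>" for \<beta>
  proof -
    have "f \<beta> = \<beta> \<bullet> adjoint f 1" using adjoint_works[OF f(1), of \<beta> 1] by simp
    also have "\<dots> = w \<bullet> \<beta>"
      using wz(2)[of \<beta>] that
      by (simp add: wz(3) inner_add_right orthogonal_def inner_commute span_base)
    finally show ?thesis by simp
  qed
  then show "\<exists>w. w \<in> span \<Delta> \<and> (\<forall>\<beta>\<in>\<Delta>. w \<bullet> \<beta> = (if \<beta> = \<alpha> then 1 else 0))"
    using wz(1) f(2) by auto
qed (rule span_inner_eqI, auto simp: inner_commute)

lemma coweight_in_span: "\<omega> \<alpha> \<in> span \<Delta>"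
  and simple_inner_coweight: "\<beta> \<in> \<Delta> \<Longrightarrow> \<beta> \<bullet> \<omega> \<alpha> = (if \<beta> = \<alpha> then 1 else 0)"
  using theI'[OF coweight_ex1[of \<alpha>]] unfolding coweight_def[symmetric]
  by (auto simp: inner_commute)

lemma coweight_eqI:
  assumes "w \<in> span \<Delta>" "\<And>\<beta>. \<beta> \<in> \<Delta> \<Longrightarrow> \<beta> \<bullet> w = (if \<beta> = \<alpha> then 1 else 0)"
  shows "\<omega> \<alpha> = w"
  by (rule span_inner_eqI[OF coweight_in_span assms(1)]) (simp add: assms(2) simple_inner_coweight)

text \<open>Turns coordinates into inner products, which are linear without membership conditions.
  All coefficient arguments below are phrased in this form.\<close>

lemma representation_eq_coweight:
  assumes "x \<in> span \<Delta>" "\<alpha> \<in> \<Delta>"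
  shows "representation \<Delta> x \<alpha> = x \<bullet> \<omega> \<alpha>"
proof -
  have "x = (\<Sum>\<gamma>\<in>\<Delta>. representation \<Delta> x \<gamma> *\<^sub>R \<gamma>)"
    using sum_representation_eq[OF simple_independent assms(1) finite_simple order_refl] by simp
  then have "x \<bullet> \<omega> \<alpha> = (\<Sum>\<gamma>\<in>\<Delta>. representation \<Delta> x \<gamma> *\<^sub>R \<gamma>) \<bullet> \<omega> \<alpha>" by metis
  also have "\<dots> = (\<Sum>\<gamma>\<in>\<Delta>. representation \<Delta> x \<gamma> * (\<gamma> \<bullet> \<omega> \<alpha>))"
    by (simp add: inner_sum_left)
  also have "\<dots> = (\<Sum>\<gamma>\<in>\<Delta>. if \<gamma> = \<alpha> then representation \<Delta> x \<gamma> else 0)"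
    by (rule sum.cong) (auto simp: simple_inner_coweight)
  finally show ?thesis using assms(2) finite_simple by simp
qed

lemma simple_expansion:
  assumes "x \<in> span \<Delta>"
  shows "x = (\<Sum>\<gamma>\<in>\<Delta>. (x \<bullet> \<omega> \<gamma>) *\<^sub>R \<gamma>)"
proof -
  have "x = (\<Sum>\<gamma>\<in>\<Delta>. representation \<Delta> x \<gamma> *\<^sub>R \<gamma>)"
    using sum_representation_eq[OF simple_independent assms(1) finite_simple order_refl] by simp
  also have "\<dots> = (\<Sum>\<gamma>\<in>\<Delta>. (x \<bullet> \<omega> \<gamma>) *\<^sub>R \<gamma>)"
    by (rule sum.cong) (simp_all add: representation_eq_coweight assms)
  finally show ?thesis .
qed

lemma inner_expansion:
  assumes "x \<in> span \<Delta>"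
  shows "x \<bullet> y = (\<Sum>\<gamma>\<in>\<Delta>. (x \<bullet> \<omega> \<gamma>) * (\<gamma> \<bullet> y))"
proof -
  have "x \<bullet> y = (\<Sum>\<gamma>\<in>\<Delta>. (x \<bullet> \<omega> \<gamma>) *\<^sub>R \<gamma>) \<bullet> y" using simple_expansion[OF assms] by simp
  then show ?thesis by (simp add: inner_sum_left)
qed

lemma root_coeffs:
  assumes "\<beta> \<in> \<Phi>"
  shows "(\<forall>\<gamma>\<in>\<Delta>. \<beta> \<bullet> \<omega> \<gamma> \<ge> 0) \<or> (\<forall>\<gamma>\<in>\<Delta>. \<beta> \<bullet> \<omega> \<gamma> \<le> 0)"
proof -
  have "(\<forall>\<alpha>\<in>\<Delta>. representation \<Delta> \<beta> \<alpha> \<in> \<nat>) \<or> (\<forall>\<alpha>\<in>\<Delta>. - representation \<Delta> \<beta> \<alpha> \<in> \<nat>)"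
    using simple_roots assms by (simp add: simple_roots_def)
  then show ?thesis
    using representation_eq_coweight[OF root_in_span[OF assms]]
    by (metis (no_types, lifting) Nats_cases neg_0_le_iff_le of_nat_0_le_iff)
qed

lemma positive_root:
  assumes "\<beta> \<in> \<Phi>" "\<gamma> \<in> \<Delta>" "\<beta> \<bullet> \<omega> \<gamma> > 0" "\<alpha> \<in> \<Delta>"
  shows "\<beta> \<bullet> \<omega> \<alpha> \<ge> 0"
  using root_coeffs[OF assms(1)] assms by (meson not_le)

lemma reflection_coeff:
  assumes "\<alpha> \<in> \<Delta>"
  shows "root_reflection \<alpha> \<beta> \<bullet> \<omega> \<gamma>
    = \<beta> \<bullet> \<omega> \<gamma> - (if \<alpha> = \<gamma> then 2 * (\<beta> \<bullet> \<alpha>) / (\<alpha> \<bullet> \<alpha>) else 0)"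
  using simple_inner_coweight[OF assms] by (simp add: root_reflection_inner)

text \<open>Reflecting \<beta> in \<alpha> keeps the coefficient 1 at \<beta>, so the result is a
  positive root; its coefficient at \<alpha> is the negated Cartan integer, which must therefore be
  nonnegative.\<close>

lemma simple_inner_nonpos:
  assumes "\<alpha> \<in> \<Delta>" "\<beta> \<in> \<Delta>" "\<alpha> \<noteq> \<beta>"
  shows "\<alpha> \<bullet> \<beta> \<le> 0"
proof -
  have r: "root_reflection \<alpha> \<beta> \<in> \<Phi>"
    using root_reflection_in[OF root_system] simple_in assms by blast
  have "root_reflection \<alpha> \<beta> \<bullet> \<omega> \<beta> > 0"
    using assms by (simp add: reflection_coeff simple_inner_coweight)
  then have "root_reflection \<alpha> \<beta> \<bullet> \<omega> \<alpha> \<ge> 0" using positive_root[OF r] assms by blast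
  then have "2 * (\<beta> \<bullet> \<alpha>) / (\<alpha> \<bullet> \<alpha>) \<le> 0"
    using assms by (simp add: reflection_coeff simple_inner_coweight)
  moreover have "\<alpha> \<bullet> \<alpha> > 0" using simple_nonzero[OF assms(1)] by simp
  ultimately show ?thesis by (simp add: divide_le_0_iff inner_commute)
qed

text \<open>The quantity optimised whenever a root is chosen extremally: a simple reflection changes
  one coefficient, so it moves the height by exactly that change.\<close>

definition height :: "'a \<Rightarrow> real" where "height x = (\<Sum>\<gamma>\<in>\<Delta>. x \<bullet> \<omega> \<gamma>)"

lemma height_reflection:
  assumes "\<alpha> \<in> \<Delta>"
  shows "height (root_reflection \<alpha> \<beta>) = height \<beta> - 2 * (\<beta> \<bullet> \<alpha>) / (\<alpha> \<bullet> \<alpha>)"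
  using assms finite_simple
  by (simp add: height_def reflection_coeff[OF assms] sum_subtractf)

end


section \<open>The support of a root is connected\<close>

context based_root_system
begin

text \<open>
  Reflecting a counterexample \<open>x\<close> of minimal height in a simple root \<open>c\<close> with \<open>(x, c) > 0\<close> must kill
  its whole component on the side of \<open>c\<close>, which is therefore \<open>n c\<close> with \<open>n = 2(x, c)/(c, c) = 2n\<close>.
\<close>

lemma positive_split:
  assumes AB: "A \<union> B = \<Delta>" "A \<inter> B = {}"
    and orth: "\<And>a b. a \<in> A \<Longrightarrow> b \<in> B \<Longrightarrow> a \<bullet> b = 0"
    and \<beta>: "\<beta> \<in> \<Phi>" "\<forall>\<gamma>\<in>\<Delta>. \<beta> \<bullet> \<omega> \<gamma> \<ge> 0"
  shows "(\<forall>a\<in>A. \<beta> \<bullet> \<omega> a = 0) \<or> (\<forall>b\<in>B. \<beta> \<bullet> \<omega> b = 0)"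
proof (rule ccontr)
  define M where "M = {\<beta>\<in>\<Phi>. (\<forall>\<gamma>\<in>\<Delta>. \<beta> \<bullet> \<omega> \<gamma> \<ge> 0) \<and>
    (\<exists>a\<in>A. \<beta> \<bullet> \<omega> a \<noteq> 0) \<and> (\<exists>b\<in>B. \<beta> \<bullet> \<omega> b \<noteq> 0)}"
  assume "\<not> ?thesis"
  then have "\<beta> \<in> M" using \<beta> by (auto simp: M_def)
  then have "M \<noteq> {}" by blast
  moreover have "finite M" using root_system_finite[OF root_system] by (simp add: M_def)
  ultimately obtain x where x: "x \<in> M" and xmin: "\<And>y. y \<in> M \<Longrightarrow> \<not> height y < height x"
    using ex_is_arg_min_if_finite[of M height] unfolding is_arg_min_def by blast
  have xr: "x \<in> \<Phi>" and xpos: "\<And>\<gamma>. \<gamma> \<in> \<Delta> \<Longrightarrow> x \<bullet> \<omega> \<gamma> \<ge> 0" using x by (auto simp: M_def)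
  \<comment> \<open>Stated for an arbitrary ordered pair \<open>C\<close>, \<open>D\<close>, because
    the simple root \<open>c\<close> may turn up on either side.\<close>
  have no: False
    if CD: "C \<union> D = \<Delta>" "C \<inter> D = {}" "\<And>c d. c \<in> C \<Longrightarrow> d \<in> D \<Longrightarrow> c \<bullet> d = 0"
      and M: "\<And>y. y \<in> \<Phi> \<Longrightarrow> \<forall>\<gamma>\<in>\<Delta>. y \<bullet> \<omega> \<gamma> \<ge> 0 \<Longrightarrow> \<exists>c\<in>C. y \<bullet> \<omega> c \<noteq> 0 \<Longrightarrow>
        \<exists>d\<in>D. y \<bullet> \<omega> d \<noteq> 0 \<Longrightarrow> y \<in> M"
      and d: "\<exists>d\<in>D. x \<bullet> \<omega> d \<noteq> 0" and c: "c \<in> C" "x \<bullet> c > 0" for C D c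
  proof -
    define n where "n = 2 * (x \<bullet> c) / (c \<bullet> c)"
    define y where "y = root_reflection c x"
    have c\<Delta>: "c \<in> \<Delta>" using CD c by blast
    have cc: "c \<bullet> c > 0" using simple_nonzero[OF c\<Delta>] by simp
    then have n: "n > 0" using c by (simp add: n_def)
    have yc: "y \<bullet> \<omega> \<gamma> = x \<bullet> \<omega> \<gamma> - (if c = \<gamma> then n else 0)" for \<gamma>
      by (simp add: y_def n_def reflection_coeff[OF c\<Delta>])
    have yr: "y \<in> \<Phi>"
      unfolding y_def by (rule root_reflection_in[OF root_system simple_in[OF c\<Delta>] xr])
    obtain d where d: "d \<in> D" "x \<bullet> \<omega> d \<noteq> 0" using d by blast
    have d\<Delta>: "d \<in> \<Delta>" and dc: "c \<noteq> d" using CD d c by auto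
    \<comment> \<open>The untouched positive coefficient at \<open>d\<close> certifies that
      \<open>y\<close> is again a positive root.\<close>
    have "y \<bullet> \<omega> d > 0" using xpos[OF d\<Delta>] d(2) dc by (simp add: yc)
    then have "\<forall>\<gamma>\<in>\<Delta>. y \<bullet> \<omega> \<gamma> \<ge> 0" using positive_root[OF yr d\<Delta>] by blast
    moreover have "\<exists>d\<in>D. y \<bullet> \<omega> d \<noteq> 0" using d dc yc by force
    moreover have "height y < height x"
      using n by (simp add: y_def height_reflection[OF c\<Delta>] n_def)
    ultimately have y0: "\<forall>\<gamma>\<in>C. y \<bullet> \<omega> \<gamma> = 0" using M[OF yr] xmin by blast
    have "(x \<bullet> \<omega> \<gamma>) * (\<gamma> \<bullet> c) = (if \<gamma> = c then n * (c \<bullet> c) else 0)" if "\<gamma> \<in> \<Delta>" for \<gamma>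
    proof (cases "\<gamma> \<in> C")
      case True
      then show ?thesis using y0 yc[of \<gamma>] by (auto split: if_splits)
    next
      case False
      then have "\<gamma> \<in> D" "\<gamma> \<noteq> c" using CD that c by auto
      then show ?thesis using CD(3)[OF c(1)] by (simp add: inner_commute)
    qed
    then have "x \<bullet> c = (\<Sum>\<gamma>\<in>\<Delta>. if \<gamma> = c then n * (c \<bullet> c) else 0)"
      using inner_expansion[OF root_in_span[OF xr], of c] by simp
    also have "\<dots> = n * (c \<bullet> c)" using c\<Delta> finite_simple by simp
    finally have "n = 2 * n" using cc by (simp add: n_def)
    then show False using n by simp
  qed
  \<comment> \<open>The squared length of \<open>x\<close> is the sum over \<gamma> of its
    nonnegative coefficients times the inner products of \<gamma> with \<open>x\<close>, so one of
    these inner products is positive.\<close>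
  have "x \<bullet> x > 0" using root_system_nonzero[OF root_system] xr by auto
  then have "\<not> (\<forall>\<gamma>\<in>\<Delta>. (x \<bullet> \<omega> \<gamma>) * (\<gamma> \<bullet> x) \<le> 0)"
    using inner_expansion[OF root_in_span[OF xr], of x] sum_nonpos by (metis (mono_tags, lifting) not_le)
  then obtain c where "c \<in> \<Delta>" "(x \<bullet> \<omega> c) * (c \<bullet> x) > 0" by (auto simp: not_le)
  then have c: "c \<in> \<Delta>" "x \<bullet> c > 0"
    using xpos[of c] by (auto simp: zero_less_mult_iff inner_commute)
  show False
  proof (cases "c \<in> A")
    case True
    show False
      by (rule no[OF AB orth _ _ True c(2)]) (use x in \<open>auto simp: M_def\<close>)
  next
    case False
    then have "c \<in> B" using AB c by blast
    show False
    proof (rule no[OF _ _ _ _ _ \<open>c \<in> B\<close> c(2), of A])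
      show "b \<bullet> a = 0" if "b \<in> B" "a \<in> A" for a b using orth[OF that(2,1)] by (simp add: inner_commute)
    qed (use x AB in \<open>auto simp: M_def\<close>)
  qed
qed

lemma root_split:
  assumes AB: "A \<union> B = \<Delta>" "A \<inter> B = {}"
    and orth: "\<And>a b. a \<in> A \<Longrightarrow> b \<in> B \<Longrightarrow> a \<bullet> b = 0" and \<beta>: "\<beta> \<in> \<Phi>"
  shows "(\<forall>a\<in>A. \<beta> \<bullet> \<omega> a = 0) \<or> (\<forall>b\<in>B. \<beta> \<bullet> \<omega> b = 0)"
  using root_coeffs[OF \<beta>]
proof
  assume "\<forall>\<gamma>\<in>\<Delta>. \<beta> \<bullet> \<omega> \<gamma> \<ge> 0"
  then show ?thesis using positive_split[OF AB orth \<beta>] by blast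
next
  assume "\<forall>\<gamma>\<in>\<Delta>. \<beta> \<bullet> \<omega> \<gamma> \<le> 0"
  then show ?thesis
    using positive_split[OF AB orth root_uminus_in[OF root_system \<beta>]] by simp
qed

end

subsection \<open>The highest root\<close>

locale irreducible_based_root_system = based_root_system +
  assumes irreducible: "irreducible_root_system \<Phi>"
begin

text \<open>If the base split orthogonally, \<open>root_split\<close> would put the support of every
  root on one side, and the roots supported on \<open>A\<close> would be orthogonal to all the
  others, against irreducibility.\<close>

lemma simple_connected:
  assumes AB: "A \<union> B = \<Delta>" "A \<inter> B = {}" "A \<noteq> {}" "B \<noteq> {}"
    and orth: "\<And>a b. a \<in> A \<Longrightarrow> b \<in> B \<Longrightarrow> a \<bullet> b = 0"
  shows False
proof -
  define X where "X = {\<beta>\<in>\<Phi>. \<forall>b\<in>B. \<beta> \<bullet> \<omega> b = 0}"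
  obtain a b where ab: "a \<in> A" "b \<in> B" using AB by blast
  have s: "a \<in> \<Delta>" "b \<in> \<Delta>" using ab AB by auto
  have "\<forall>b\<in>B. b \<noteq> a" using ab AB by blast
  then have "a \<in> X" using s(1) simple_in by (auto simp: X_def simple_inner_coweight)
  moreover have "b \<in> \<Phi> - X" using ab s(2) simple_in by (force simp: X_def simple_inner_coweight)
  moreover have "x \<bullet> y = 0" if x: "x \<in> X" and y: "y \<in> \<Phi> - X" for x y
  proof -
    have y0: "\<forall>a\<in>A. y \<bullet> \<omega> a = 0" using root_split[OF AB(1,2) orth] y by (auto simp: X_def)
    have "x \<bullet> y = (\<Sum>\<gamma>\<in>\<Delta>. (x \<bullet> \<omega> \<gamma>) * (\<gamma> \<bullet> y))"
      using inner_expansion root_in_span x by (simp add: X_def)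
    also have "\<dots> = 0"
    proof (rule sum.neutral, rule ballI)
      fix \<gamma> assume \<gamma>: "\<gamma> \<in> \<Delta>"
      show "(x \<bullet> \<omega> \<gamma>) * (\<gamma> \<bullet> y) = 0"
      proof (cases "\<gamma> \<in> B")
        case True
        then show ?thesis using x by (simp add: X_def)
      next
        case False
        then have "\<gamma> \<in> A" using AB \<gamma> by blast
        have "y \<bullet> \<gamma> = (\<Sum>\<delta>\<in>\<Delta>. (y \<bullet> \<omega> \<delta>) * (\<delta> \<bullet> \<gamma>))"
          using inner_expansion root_in_span y by simp
        also have "\<dots> = 0"
          using y0 orth[OF \<open>\<gamma> \<in> A\<close>] AB(1) by (intro sum.neutral) (auto simp: inner_commute)
        finally show ?thesis by (simp add: inner_commute)
      qed
    qed
    finally show ?thesis .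
  qed
  moreover have "X \<inter> (\<Phi> - X) = {}" "X \<union> (\<Phi> - X) = \<Phi>" by (auto simp: X_def)
  ultimately have "X \<noteq> {} \<and> \<Phi> - X \<noteq> {} \<and> X \<inter> (\<Phi> - X) = {} \<and> X \<union> (\<Phi> - X) = \<Phi> \<and>
      (\<forall>x\<in>X. \<forall>y\<in>\<Phi> - X. x \<bullet> y = 0)" by auto
  then show False using irreducible unfolding irreducible_root_system_def by meson
qed

text \<open>Maximality in the coefficientwise partial order, whereas \<open>highest_root\<close>
  asks for a greatest element; \<open>maximal_root_unique\<close> closes the gap.\<close>

definition maximal_root :: "'a \<Rightarrow> bool" where
  "maximal_root \<theta> \<longleftrightarrow> \<theta> \<in> \<Phi> \<and> (\<forall>\<beta>\<in>\<Phi>. (\<forall>\<gamma>\<in>\<Delta>. \<theta> \<bullet> \<omega> \<gamma> \<le> \<beta> \<bullet> \<omega> \<gamma>) \<longrightarrow> \<beta> = \<theta>)"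

lemma coeffs_eqI:
  assumes "x \<in> span \<Delta>" "y \<in> span \<Delta>" "\<And>\<gamma>. \<gamma> \<in> \<Delta> \<Longrightarrow> x \<bullet> \<omega> \<gamma> = y \<bullet> \<omega> \<gamma>"
  shows "x = y"
proof -
  have "(\<Sum>\<gamma>\<in>\<Delta>. (x \<bullet> \<omega> \<gamma>) *\<^sub>R \<gamma>) = (\<Sum>\<gamma>\<in>\<Delta>. (y \<bullet> \<omega> \<gamma>) *\<^sub>R \<gamma>)"
    by (rule sum.cong) (simp_all add: assms(3))
  then show ?thesis using simple_expansion[OF assms(1)] simple_expansion[OF assms(2)] by argo
qed

text \<open>A root of largest height among those above \<beta> is maximal: passing to a root above
  it adds nonnegative amounts to the coefficients, and their sum cannot be positive.\<close>

lemma maximal_root_exists: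
  assumes "\<beta> \<in> \<Phi>"
  obtains \<theta> where "maximal_root \<theta>" "\<And>\<gamma>. \<gamma> \<in> \<Delta> \<Longrightarrow> \<beta> \<bullet> \<omega> \<gamma> \<le> \<theta> \<bullet> \<omega> \<gamma>"
proof -
  define S where "S = {x\<in>\<Phi>. \<forall>\<gamma>\<in>\<Delta>. \<beta> \<bullet> \<omega> \<gamma> \<le> x \<bullet> \<omega> \<gamma>}"
  have "finite S" "S \<noteq> {}"
    using root_system_finite[OF root_system] assms by (auto simp: S_def)
  then obtain \<theta> where \<theta>: "\<theta> \<in> S" "\<And>y. y \<in> S \<Longrightarrow> \<not> - height y < - height \<theta>"
    using ex_is_arg_min_if_finite[of S "\<lambda>x. - height x"] unfolding is_arg_min_def by blast
  have "maximal_root \<theta>" unfolding maximal_root_def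
  proof (intro conjI ballI impI)
    show "\<theta> \<in> \<Phi>" using \<theta> by (simp add: S_def)
    fix x assume x: "x \<in> \<Phi>" and le: "\<forall>\<gamma>\<in>\<Delta>. \<theta> \<bullet> \<omega> \<gamma> \<le> x \<bullet> \<omega> \<gamma>"
    have "x \<in> S" using x le \<theta>(1) by (fastforce simp: S_def)
    then have "(\<Sum>\<gamma>\<in>\<Delta>. x \<bullet> \<omega> \<gamma> - \<theta> \<bullet> \<omega> \<gamma>) \<le> 0"
      using \<theta>(2)[of x] by (simp add: height_def sum_subtractf)
    then have "(\<Sum>\<gamma>\<in>\<Delta>. x \<bullet> \<omega> \<gamma> - \<theta> \<bullet> \<omega> \<gamma>) = 0"
      using le by (intro antisym sum_nonneg) auto
    then have "x \<bullet> \<omega> \<gamma> = \<theta> \<bullet> \<omega> \<gamma>" if "\<gamma> \<in> \<Delta>" for \<gamma>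
      using that le sum_nonneg_eq_0_iff[OF finite_simple, of "\<lambda>\<gamma>. x \<bullet> \<omega> \<gamma> - \<theta> \<bullet> \<omega> \<gamma>"] by simp
    then show "x = \<theta>"
      using coeffs_eqI root_in_span x \<theta>(1) by (simp add: S_def)
  qed
  then show thesis using that \<theta>(1) by (simp add: S_def)
qed

text \<open>With a negative inner product, reflection in \<gamma> would raise the coefficient at
  \<gamma> and keep all others.\<close>

lemma maximal_root_dominant:
  assumes "maximal_root \<theta>" "\<gamma> \<in> \<Delta>"
  shows "\<theta> \<bullet> \<gamma> \<ge> 0"
proof (rule ccontr)
  assume "\<not> ?thesis"
  moreover have gg: "\<gamma> \<bullet> \<gamma> > 0" using simple_nonzero[OF assms(2)] by simp
  ultimately have neg: "2 * (\<theta> \<bullet> \<gamma>) / (\<gamma> \<bullet> \<gamma>) < 0" by (simp add: divide_less_0_iff)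
  have "root_reflection \<gamma> \<theta> \<in> \<Phi>"
    using assms root_reflection_in[OF root_system] simple_in by (simp add: maximal_root_def)
  then have "root_reflection \<gamma> \<theta> = \<theta>"
    using assms(1) neg unfolding maximal_root_def by (simp add: reflection_coeff[OF assms(2)])
  then have "root_reflection \<gamma> \<theta> \<bullet> \<omega> \<gamma> = \<theta> \<bullet> \<omega> \<gamma>" by simp
  then have "2 * (\<theta> \<bullet> \<gamma>) / (\<gamma> \<bullet> \<gamma>) = 0" unfolding reflection_coeff[OF assms(2)] by simp
  then show False using neg by linarith
qed

text \<open>For a simple root \<open>b\<close> outside the support \<open>A\<close>, every term of
  the expansion of the inner product with \<open>b\<close> is nonpositive, while dominance makes the
  sum nonnegative. So all terms vanish, \<open>A\<close> is orthogonal to its complement, and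
  \<open>simple_connected\<close> leaves no complement.\<close>

lemma maximal_root_coeff_pos:
  assumes max: "maximal_root \<theta>" and "\<gamma> \<in> \<Delta>"
  shows "\<theta> \<bullet> \<omega> \<gamma> > 0"
proof -
  have \<theta>: "\<theta> \<in> \<Phi>" using max by (simp add: maximal_root_def)
  then have nz: "\<theta> \<noteq> 0" using root_system_nonzero[OF root_system] by blast
  have nonneg: "\<forall>\<gamma>\<in>\<Delta>. \<theta> \<bullet> \<omega> \<gamma> \<ge> 0"
  proof (rule ccontr)
    assume "\<not> ?thesis"
    \<comment> \<open>A root that is not positive is negative, and then its opposite would lie above
      it.\<close>
    then have "\<forall>\<gamma>\<in>\<Delta>. \<theta> \<bullet> \<omega> \<gamma> \<le> (- \<theta>) \<bullet> \<omega> \<gamma>" using root_coeffs[OF \<theta>] by auto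
    then have "- \<theta> = \<theta>"
      using max root_uminus_in[OF root_system \<theta>] unfolding maximal_root_def by blast
    then have "2 *\<^sub>R \<theta> = 0" by (metis add.right_inverse scaleR_2)
    then show False using nz by simp
  qed
  define A where "A = {\<gamma>\<in>\<Delta>. \<theta> \<bullet> \<omega> \<gamma> \<noteq> 0}"
  have "A \<noteq> {}"
  proof
    assume "A = {}"
    then have "\<theta> = 0"
      using simple_expansion[OF root_in_span[OF \<theta>]] by (simp add: A_def)
    then show False using nz by simp
  qed
  moreover have "a \<bullet> b = 0" if ab: "a \<in> A" "b \<in> \<Delta> - A" for a b
  proof -
    have t: "(\<theta> \<bullet> \<omega> \<gamma>) * (\<gamma> \<bullet> b) \<le> 0" if "\<gamma> \<in> \<Delta>" for \<gamma>
    proof (cases "\<gamma> = b")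
      case True then show ?thesis using ab by (simp add: A_def)
    next
      case False
      then show ?thesis
        using that ab nonneg simple_inner_nonpos[of \<gamma> b] by (simp add: mult_nonneg_nonpos)
    qed
    have "(\<Sum>\<gamma>\<in>\<Delta>. - ((\<theta> \<bullet> \<omega> \<gamma>) * (\<gamma> \<bullet> b))) \<le> 0"
      using maximal_root_dominant[OF max, of b] ab inner_expansion[OF root_in_span[OF \<theta>], of b]
      by (simp add: sum_negf)
    then have "(\<Sum>\<gamma>\<in>\<Delta>. - ((\<theta> \<bullet> \<omega> \<gamma>) * (\<gamma> \<bullet> b))) = 0"
      using t by (intro antisym sum_nonneg) auto
    then have "\<forall>\<gamma>\<in>\<Delta>. \<theta> \<bullet> \<omega> \<gamma> = 0 \<or> \<gamma> \<bullet> b = 0"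
      using t sum_nonneg_eq_0_iff[OF finite_simple, of "\<lambda>\<gamma>. - ((\<theta> \<bullet> \<omega> \<gamma>) * (\<gamma> \<bullet> b))"]
      by simp
    then show ?thesis using ab by (auto simp: A_def)
  qed
  moreover have "A \<union> (\<Delta> - A) = \<Delta>" "A \<inter> (\<Delta> - A) = {}" by (auto simp: A_def)
  ultimately have "\<Delta> - A = {}" using simple_connected[of A "\<Delta> - A"] by metis
  then show ?thesis using assms nonneg by (force simp: A_def)
qed

text \<open>All coefficients of \<eta> are positive and \<theta> is dominant and nonzero, so their
  inner product is positive. Then \<open>root_diff_in\<close> makes the difference a root, whose
  coefficients have one sign: the two maximal roots are comparable.\<close>

lemma maximal_root_unique:
  assumes max: "maximal_root \<theta>" "maximal_root \<eta>"
  shows "\<theta> = \<eta>"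
proof (rule ccontr)
  assume ne: "\<theta> \<noteq> \<eta>"
  have r: "\<theta> \<in> \<Phi>" "\<eta> \<in> \<Phi>" using max by (simp_all add: maximal_root_def)
  have nn: "(\<eta> \<bullet> \<omega> \<gamma>) * (\<gamma> \<bullet> \<theta>) \<ge> 0" if "\<gamma> \<in> \<Delta>" for \<gamma>
    using maximal_root_coeff_pos[OF max(2) that] maximal_root_dominant[OF max(1) that]
    by (simp add: inner_commute)
  have "\<theta> \<bullet> \<eta> \<noteq> 0"
  proof
    assume "\<theta> \<bullet> \<eta> = 0"
    then have s: "(\<Sum>\<gamma>\<in>\<Delta>. (\<eta> \<bullet> \<omega> \<gamma>) * (\<gamma> \<bullet> \<theta>)) = 0"
      using inner_expansion[OF root_in_span[OF r(2)], of \<theta>] by (simp add: inner_commute)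
    have "\<forall>\<gamma>\<in>\<Delta>. (\<eta> \<bullet> \<omega> \<gamma>) * (\<gamma> \<bullet> \<theta>) = 0"
      by (rule sum_nonneg_eq_0_iff[OF finite_simple, THEN iffD1]) (use nn s in auto)
    then have "\<forall>\<gamma>\<in>\<Delta>. \<gamma> \<bullet> \<theta> = 0"
      using maximal_root_coeff_pos[OF max(2)] by fastforce
    then have "\<theta> \<bullet> \<theta> = 0" using inner_expansion[OF root_in_span[OF r(1)], of \<theta>] by simp
    then show False using r root_system_nonzero[OF root_system] by auto
  qed
  moreover have "\<eta> \<bullet> \<theta> \<ge> 0"
    unfolding inner_expansion[OF root_in_span[OF r(2)], of \<theta>] by (rule sum_nonneg) (rule nn)
  ultimately have "\<theta> \<bullet> \<eta> > 0" by (simp add: inner_commute)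
  then have "\<theta> - \<eta> \<in> \<Phi>" by (rule root_diff_in[OF root_system r ne])
  then have "(\<forall>\<gamma>\<in>\<Delta>. \<eta> \<bullet> \<omega> \<gamma> \<le> \<theta> \<bullet> \<omega> \<gamma>) \<or> (\<forall>\<gamma>\<in>\<Delta>. \<theta> \<bullet> \<omega> \<gamma> \<le> \<eta> \<bullet> \<omega> \<gamma>)"
    using root_coeffs[of "\<theta> - \<eta>"] by (simp add: inner_diff_left)
  then show False using max r ne unfolding maximal_root_def by blast
qed

abbreviation \<theta> :: 'a where "\<theta> \<equiv> highest_root \<Delta> \<Phi>"

text \<open>Every root lies below some maximal root and there is only one, so it is the greatest
  root and the definite description denotes it.\<close>

lemma highest_root_maximal: "maximal_root \<theta>"
  and coeff_le_highest: "\<beta> \<in> \<Phi> \<Longrightarrow> \<gamma> \<in> \<Delta> \<Longrightarrow> \<beta> \<bullet> \<omega> \<gamma> \<le> \<theta> \<bullet> \<omega> \<gamma>"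
proof -
  have \<Delta>: "\<Delta> \<inter> \<Phi> = \<Delta>" using simple_subset by blast
  obtain \<eta> where \<eta>: "maximal_root \<eta>"
    using maximal_root_exists root_system_nonempty[OF root_system] by (metis all_not_in_conv)
  have le: "\<beta> \<bullet> \<omega> \<gamma> \<le> \<eta> \<bullet> \<omega> \<gamma>" if "\<beta> \<in> \<Phi>" "\<gamma> \<in> \<Delta>" for \<beta> \<gamma>
    using maximal_root_exists[OF that(1)] maximal_root_unique[OF \<eta>] that(2) by metis
  have "\<theta> = \<eta>"
    unfolding highest_root_def \<Delta>
  proof (rule the_equality)
    show "\<eta> \<in> \<Phi> \<and> (\<forall>\<beta>\<in>\<Phi>. \<forall>\<alpha>\<in>\<Delta>. representation \<Delta> \<beta> \<alpha> \<le> representation \<Delta> \<eta> \<alpha>)"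
      using \<eta> le by (simp add: representation_eq_coweight root_in_span maximal_root_def)
    fix \<xi> assume \<xi>: "\<xi> \<in> \<Phi> \<and> (\<forall>\<beta>\<in>\<Phi>. \<forall>\<alpha>\<in>\<Delta>. representation \<Delta> \<beta> \<alpha> \<le> representation \<Delta> \<xi> \<alpha>)"
    then have "\<forall>\<gamma>\<in>\<Delta>. \<eta> \<bullet> \<omega> \<gamma> \<le> \<xi> \<bullet> \<omega> \<gamma>"
      using \<eta> by (auto simp: representation_eq_coweight root_in_span maximal_root_def)
    then show "\<xi> = \<eta>" using \<eta> \<xi> unfolding maximal_root_def by blast
  qed
  then show "maximal_root \<theta>" and "\<beta> \<in> \<Phi> \<Longrightarrow> \<gamma> \<in> \<Delta> \<Longrightarrow> \<beta> \<bullet> \<omega> \<gamma> \<le> \<theta> \<bullet> \<omega> \<gamma>"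
    using \<eta> le by auto
qed

lemma highest_root_in: "\<theta> \<in> \<Phi>"
  using highest_root_maximal by (simp add: maximal_root_def)

lemmas highest_coeff_pos = maximal_root_coeff_pos[OF highest_root_maximal]

abbreviation \<o> :: "'a \<Rightarrow> 'a" where "\<o> \<equiv> scaled_coweight \<Delta> \<Phi>"

lemma inner_scaled_coweight:
  assumes "\<gamma> \<in> \<Delta>"
  shows "x \<bullet> \<o> \<gamma> = (x \<bullet> \<omega> \<gamma>) / (\<theta> \<bullet> \<omega> \<gamma>)"
proof -
  have "\<Delta> \<inter> \<Phi> = \<Delta>" using simple_subset by blast
  then show ?thesis
    using assms
    by (simp add: scaled_coweight_def highest_root_coeff_def representation_eq_coweight
        root_in_span highest_root_in)
qed

lemma scaled_coweight_in_span: "\<o> \<gamma> \<in> span \<Delta>"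
  by (simp add: scaled_coweight_def span_scale coweight_in_span)

lemma inner_scaled_coweight_eq_1:
  assumes "\<gamma> \<in> \<Delta>"
  shows "x \<bullet> \<o> \<gamma> = 1 \<longleftrightarrow> x \<bullet> \<omega> \<gamma> = \<theta> \<bullet> \<omega> \<gamma>"
  using highest_coeff_pos[OF assms] by (auto simp: inner_scaled_coweight[OF assms])

lemma scaled_coweight_inj:
  assumes "\<alpha> \<in> \<Delta>" "\<gamma> \<in> \<Delta>" "\<o> \<alpha> = \<o> \<gamma>"
  shows "\<alpha> = \<gamma>"
proof (rule ccontr)
  assume "\<alpha> \<noteq> \<gamma>"
  moreover have "\<alpha> \<bullet> \<o> \<alpha> = \<alpha> \<bullet> \<o> \<gamma>" using assms by simp
  ultimately show False
    using highest_coeff_pos[OF assms(1)]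
    by (simp add: inner_scaled_coweight assms(1,2) simple_inner_coweight)
qed

end


subsection \<open>Facets of root polytopes\<close>

text \<open>These are the vertices of the polar of the root polytope inside
  \<open>span \<Phi>\<close>: the constraints that are tight at \<open>v\<close> have full
  rank.\<close>

definition facet_normal :: "'a::euclidean_space set \<Rightarrow> 'a \<Rightarrow> bool" where
  "facet_normal \<Phi> v \<longleftrightarrow>
     v \<in> span \<Phi> \<and> (\<forall>\<beta>\<in>\<Phi>. \<beta> \<bullet> v \<le> 1) \<and> span {\<beta>\<in>\<Phi>. \<beta> \<bullet> v = 1} = span \<Phi>"

lemma facet_normalD:
  assumes "facet_normal \<Phi> v"
  shows "v \<in> span \<Phi>" "\<And>\<beta>. \<beta> \<in> \<Phi> \<Longrightarrow> \<beta> \<bullet> v \<le> 1" "span {\<beta>\<in>\<Phi>. \<beta> \<bullet> v = 1} = span \<Phi>"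
  using assms by (auto simp: facet_normal_def)

text \<open>The tight roots span, so they determine the normal. Most identifications of two normals
  below come from here.\<close>

lemma facet_normal_eqI:
  assumes v: "facet_normal \<Phi> v" and w: "w \<in> span \<Phi>"
    and eq: "\<And>\<beta>. \<beta> \<in> \<Phi> \<Longrightarrow> \<beta> \<bullet> v = 1 \<Longrightarrow> \<beta> \<bullet> w = 1"
  shows "w = v"
  by (rule span_inner_eqI[of _ "{\<beta>\<in>\<Phi>. \<beta> \<bullet> v = 1}"]) (use facet_normalD[OF v] w eq in auto)

lemma zero_in_root_polytope:
  assumes "root_system \<Phi>"
  shows "0 \<in> root_polytope \<Phi>"
proof -
  obtain \<alpha> where a: "\<alpha> \<in> \<Phi>" using root_system_nonempty[OF assms] by blast
  then have "- \<alpha> \<in> \<Phi>" by (rule root_uminus_in[OF assms])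
  with a have "midpoint \<alpha> (- \<alpha>) \<in> convex hull \<Phi>"
    by (meson convex_contains_segment convex_convex_hull hull_inc midpoint_in_closed_segment subsetD)
  then show ?thesis by (simp add: midpoint_def root_polytope_def)
qed

lemma affine_hull_root_polytope:
  assumes "root_system \<Phi>"
  shows "affine hull root_polytope \<Phi> = span \<Phi>"
  using affine_hull_span_0[of \<Phi>] zero_in_root_polytope[OF assms] convex_hull_subset_affine_hull
  unfolding root_polytope_def by (metis affine_hull_convex_hull subsetD)

lemma aff_dim_root_polytope:
  assumes "root_system \<Phi>"
  shows "aff_dim (root_polytope \<Phi>) = int (dim \<Phi>)"
  using affine_hull_root_polytope[OF assms]
  by (metis aff_dim_affine_hull aff_dim_subspace dim_span subspace_span)

section \<open>Slices of a convex hull by a supporting hyperplane\<close>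

lemma inner_le_convex_hull:
  assumes "\<And>\<beta>. \<beta> \<in> S \<Longrightarrow> \<beta> \<bullet> v \<le> c" "x \<in> convex hull S"
  shows "x \<bullet> v \<le> c"
proof -
  have "convex hull S \<subseteq> {x. v \<bullet> x \<le> c}"
    using convex_halfspace_le[of v c] assms(1) by (intro hull_minimal) (auto simp: inner_commute)
  then show ?thesis using assms by (auto simp: inner_commute)
qed

lemma slice_face_of:
  fixes v :: "'a::euclidean_space"
  assumes "\<And>\<beta>. \<beta> \<in> S \<Longrightarrow> \<beta> \<bullet> v \<le> c"
  shows "convex hull S \<inter> {x. x \<bullet> v = c} face_of convex hull S"
  using face_of_Int_supporting_hyperplane_le[of "convex hull S" v c]
    inner_le_convex_hull[OF assms] by (simp add: inner_commute)

text \<open>A face of the hull of a finite set is the hull of some of its points, and these points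
  must themselves lie on the hyperplane.\<close>

lemma slice_eq_convex_hull:
  fixes v :: "'a::euclidean_space"
  assumes "finite S" "\<And>\<beta>. \<beta> \<in> S \<Longrightarrow> \<beta> \<bullet> v \<le> c"
  shows "convex hull S \<inter> {x. x \<bullet> v = c} = convex hull {\<beta>\<in>S. \<beta> \<bullet> v = c}" (is "?F = convex hull ?R")
proof
  obtain S' where S': "S' \<subseteq> S" "?F = convex hull S'"
    using face_of_convex_hull_subset[OF finite_imp_compact[OF assms(1)] slice_face_of[OF assms(2)]]
    by metis
  then have "S' \<subseteq> ?F" by (simp add: hull_subset)
  then have "S' \<subseteq> ?R" using S'(1) by blast
  then show "?F \<subseteq> convex hull ?R" using S'(2) hull_mono by metis
  have "convex {x. x \<bullet> v = c}" using convex_hyperplane[of v c] by (simp add: inner_commute)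
  then have "convex ?F" by (intro convex_Int convex_convex_hull)
  moreover have "?R \<subseteq> ?F" by (auto simp: hull_inc)
  ultimately show "convex hull ?R \<subseteq> ?F" by (rule hull_minimal[rotated])
qed

text \<open>The hyperplane at height 1 misses 0, so adjoining 0 to \<open>R\<close> raises the
  affine dimension by one, and a set containing 0 has equal affine and linear dimension.\<close>

lemma aff_dim_slice:
  fixes v :: "'a::euclidean_space"
  assumes "\<And>x. x \<in> R \<Longrightarrow> x \<bullet> v = 1"
  shows "aff_dim (convex hull R) = int (dim R) - 1"
proof -
  have "affine {x. x \<bullet> v = 1}" using affine_hyperplane[of v 1] by (simp add: inner_commute)
  then have "affine hull R \<subseteq> {x. x \<bullet> v = 1}" using assms by (intro hull_minimal) auto
  then have "0 \<notin> affine hull R" by auto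
  then have "aff_dim (insert 0 R) = aff_dim R + 1" by (simp add: aff_dim_insert)
  moreover have "aff_dim (insert 0 R) = int (dim R)"
    using aff_dim_zero[of "insert 0 R"] by (simp add: hull_inc) (metis dim_span span_insert_0)
  ultimately show ?thesis by (simp add: aff_dim_convex_hull)
qed

lemma facet_normal_slice:
  assumes rs: "root_system \<Phi>" and v: "facet_normal \<Phi> v"
  shows "root_polytope \<Phi> \<inter> {x. x \<bullet> v = 1} = convex hull {\<beta>\<in>\<Phi>. \<beta> \<bullet> v = 1}"
  unfolding root_polytope_def
  by (rule slice_eq_convex_hull[OF root_system_finite[OF rs] facet_normalD(2)[OF v]])

lemma facet_normal_roots_nonempty:
  assumes rs: "root_system \<Phi>" and v: "facet_normal \<Phi> v"
  shows "{\<beta>\<in>\<Phi>. \<beta> \<bullet> v = 1} \<noteq> {}"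
proof
  assume "{\<beta>\<in>\<Phi>. \<beta> \<bullet> v = 1} = {}"
  then have "span \<Phi> = {0}" using facet_normalD(3)[OF v] by (metis span_empty)
  then have "\<Phi> \<subseteq> {0}" using span_superset by metis
  then show False using root_system_nonempty[OF rs] root_system_nonzero[OF rs] by blast
qed

lemma facet_of_root_polytope_iff:
  assumes rs: "root_system \<Phi>"
  shows "F facet_of root_polytope \<Phi> \<longleftrightarrow>
    (\<exists>v. facet_normal \<Phi> v \<and> F = root_polytope \<Phi> \<inter> {x. x \<bullet> v = 1})"
proof
  assume F: "F facet_of root_polytope \<Phi>"
  then have face: "F face_of root_polytope \<Phi>" and ne: "F \<noteq> {}"
    and ad: "aff_dim F = int (dim \<Phi>) - 1"
    by (auto simp: facet_of_def aff_dim_root_polytope[OF rs])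
  have neP: "F \<noteq> root_polytope \<Phi>" using ad aff_dim_root_polytope[OF rs] by auto
  have "polyhedron (root_polytope \<Phi>)"
    unfolding root_polytope_def
    by (simp add: polytope_imp_polyhedron polytope_convex_hull root_system_finite[OF rs])
  then have "F exposed_face_of root_polytope \<Phi>" using face by (simp add: exposed_face_of_polyhedron)
  \<comment> \<open>The exposing vector can be taken parallel to the affine hull, here
    \<open>span \<Phi>\<close>; \<open>aff\<close> at 0 then puts it into that space.\<close>
  then obtain a b where le: "root_polytope \<Phi> \<subseteq> {x. a \<bullet> x \<le> b}"
    and Feq: "F = root_polytope \<Phi> \<inter> {x. a \<bullet> x = b}" and a0: "a \<noteq> 0"
    and aff: "\<forall>w\<in>span \<Phi>. w + a \<in> span \<Phi>"
    using ne neP unfolding exposed_face_of_parallel affine_hull_root_polytope[OF rs] by blast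
  have a: "a \<in> span \<Phi>" using aff span_zero by fastforce
  have root_le: "\<beta> \<bullet> a \<le> b" if "\<beta> \<in> \<Phi>" for \<beta>
    using le that hull_inc[of \<beta> \<Phi> convex] by (auto simp: root_polytope_def inner_commute)
  \<comment> \<open>The roots are symmetric about 0, so a bound that is not positive would make
    \<open>a\<close> orthogonal to all of them.\<close>
  have "b > 0"
  proof (rule ccontr)
    assume "\<not> b > 0"
    then have "a \<bullet> \<beta> = 0" if "\<beta> \<in> \<Phi>" for \<beta>
      using root_le[OF that] root_le[OF root_uminus_in[OF rs that]] by (simp add: inner_commute)
    then show False using span_inner_zero_imp_zero[OF a] a0 by blast
  qed
  define v where "v = (1 / b) *\<^sub>R a"
  have v1: "x \<bullet> v = 1 \<longleftrightarrow> a \<bullet> x = b" for x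
    using \<open>b > 0\<close> by (auto simp: v_def inner_commute)
  have vle: "\<beta> \<bullet> v \<le> 1" if "\<beta> \<in> \<Phi>" for \<beta>
    using root_le[OF that] \<open>b > 0\<close> by (simp add: v_def)
  define R where "R = {\<beta>\<in>\<Phi>. \<beta> \<bullet> v = 1}"
  have Fv: "F = root_polytope \<Phi> \<inter> {x. x \<bullet> v = 1}" unfolding Feq v1 ..
  then have "F = convex hull R"
    using slice_eq_convex_hull[OF root_system_finite[OF rs] vle] by (simp add: root_polytope_def R_def)
  \<comment> \<open>Both sides drop by one on passing to the facet, so the tight roots have full
    rank.\<close>
  then have "int (dim R) = int (dim \<Phi>)" using ad aff_dim_slice[of R v] by (simp add: R_def)
  then have "span R = span \<Phi>" by (intro dim_eq_span) (auto simp: R_def)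
  then have "facet_normal \<Phi> v"
    unfolding facet_normal_def R_def using vle a by (simp add: v_def span_scale)
  then show "\<exists>v. facet_normal \<Phi> v \<and> F = root_polytope \<Phi> \<inter> {x. x \<bullet> v = 1}" using Fv by blast
next
  assume "\<exists>v. facet_normal \<Phi> v \<and> F = root_polytope \<Phi> \<inter> {x. x \<bullet> v = 1}"
  then obtain v where v: "facet_normal \<Phi> v" and F: "F = root_polytope \<Phi> \<inter> {x. x \<bullet> v = 1}"
    by blast
  define R where "R = {\<beta>\<in>\<Phi>. \<beta> \<bullet> v = 1}"
  have FR: "F = convex hull R" using F facet_normal_slice[OF rs v] by (simp add: R_def)
  have "aff_dim F = int (dim R) - 1" unfolding FR by (rule aff_dim_slice) (auto simp: R_def)
  moreover have "dim R = dim \<Phi>" using arg_cong[OF facet_normalD(3)[OF v], of dim] by (simp add: R_def)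
  moreover have "F face_of root_polytope \<Phi>"
    unfolding F root_polytope_def by (rule slice_face_of[OF facet_normalD(2)[OF v]])
  moreover have "F \<noteq> {}" using FR facet_normal_roots_nonempty[OF rs v] by (simp add: R_def)
  ultimately show "F facet_of root_polytope \<Phi>"
    by (simp add: facet_of_def aff_dim_root_polytope[OF rs])
qed

lemma barycenter_in_rel_interior:
  fixes R :: "'a::euclidean_space set"
  assumes "finite R" "R \<noteq> {}"
  shows "(1 / real (card R)) *\<^sub>R (\<Sum>x\<in>R. x) \<in> rel_interior (convex hull R)"
\<comment> \<open>The explicit description of the relative interior wants weights strictly between 0
  and 1, which excludes a single point with weight 1.\<close>
proof (cases "card R = 1")
  case True
  then obtain a where "R = {a}" by (auto simp: card_1_singleton_iff)
  then show ?thesis by simp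
next
  case False
  then have "card R > 1" using assms by (metis card_gt_0_iff less_one nat_neq_iff)
  then show ?thesis
    by (intro subsetD[OF explicit_subset_rel_interior_convex_hull[OF assms(1)]] CollectI
          exI[of _ "\<lambda>_. 1 / real (card R)"])
       (auto simp: scaleR_sum_right)
qed

text \<open>For the direction from standard to dominant: if the inner product of \<alpha> with
  \<open>v\<close> is negative, all roots of the facet lie on the nonpositive side of \<alpha>. A
  dominant point of the relative interior then forces the whole facet into the hyperplane orthogonal
  to \<alpha>, although its roots span a space containing \<alpha>.\<close>

lemma standard_face_iff_dominant:
  assumes rs: "root_system \<Phi>" and \<Delta>: "\<Delta> \<subseteq> \<Phi>" and v: "facet_normal \<Phi> v"
    and F: "F = root_polytope \<Phi> \<inter> {x. x \<bullet> v = 1}"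
  shows "standard_face (root_polytope \<Phi>) (fundamental_chamber \<Phi> \<Delta>) F \<longleftrightarrow> (\<forall>\<alpha>\<in>\<Delta>. \<alpha> \<bullet> v \<ge> 0)"
proof -
  define R where "R = {\<beta>\<in>\<Phi>. \<beta> \<bullet> v = 1}"
  have FR: "F = convex hull R" using F facet_normal_slice[OF rs v] by (simp add: R_def)
  have Rne: "R \<noteq> {}" using facet_normal_roots_nonempty[OF rs v] by (simp add: R_def)
  have finR: "finite R" using root_system_finite[OF rs] by (simp add: R_def)
  have facet: "F facet_of root_polytope \<Phi>"
    using facet_of_root_polytope_iff[OF rs] v F by blast
  have pos: "\<alpha> \<bullet> \<alpha> > 0" if "\<alpha> \<in> \<Delta>" for \<alpha>
    using that \<Delta> root_system_nonzero[OF rs] by (metis inner_gt_zero_iff subsetD)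
  have refl: "2 * (\<beta> \<bullet> \<alpha>) / (\<alpha> \<bullet> \<alpha>) * (\<alpha> \<bullet> v) \<ge> 0" if "\<alpha> \<in> \<Delta>" "\<beta> \<in> R" for \<alpha> \<beta>
  proof -
    have "root_reflection \<alpha> \<beta> \<in> \<Phi>"
      using root_reflection_in[OF rs] that \<Delta> by (auto simp: R_def)
    then have "root_reflection \<alpha> \<beta> \<bullet> v \<le> 1" by (rule facet_normalD(2)[OF v])
    then show ?thesis using that by (simp add: root_reflection_inner R_def)
  qed
  have root_sign: "(\<beta> \<bullet> \<alpha>) * (\<alpha> \<bullet> v) \<ge> 0" if "\<alpha> \<in> \<Delta>" "\<beta> \<in> R" for \<alpha> \<beta>
    using refl[OF that] pos[OF that(1)] by (simp add: zero_le_divide_iff zero_le_mult_iff)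
  show ?thesis
  proof
    assume "standard_face (root_polytope \<Phi>) (fundamental_chamber \<Phi> \<Delta>) F"
    then obtain x where x: "x \<in> rel_interior F" "x \<in> fundamental_chamber \<Phi> \<Delta>"
      using facet by (auto simp: standard_face_def facet_of_def)
    show "\<forall>\<alpha>\<in>\<Delta>. \<alpha> \<bullet> v \<ge> 0"
    proof (rule ballI, rule ccontr)
      fix \<alpha> assume \<alpha>: "\<alpha> \<in> \<Delta>" and neg: "\<not> \<alpha> \<bullet> v \<ge> 0"
      have le: "\<beta> \<bullet> \<alpha> \<le> 0" if "\<beta> \<in> R" for \<beta>
        using root_sign[OF \<alpha> that] neg by (simp add: zero_le_mult_iff)
      have "x \<in> F" using x(1) rel_interior_subset by blast
      then have "x \<bullet> \<alpha> \<le> 0" using inner_le_convex_hull[OF le] FR by blast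
      moreover have "x \<bullet> \<alpha> \<ge> 0" using x(2) \<alpha> by (simp add: fundamental_chamber_def)
      ultimately have "x \<bullet> \<alpha> = 0" by simp
      \<comment> \<open>A face of \<open>F\<close> through a relative interior point of
        \<open>F\<close> is all of \<open>F\<close>.\<close>
      have "F \<inter> {x. x \<bullet> \<alpha> = 0} face_of F" unfolding FR by (rule slice_face_of[OF le])
      then have "F \<subseteq> F \<inter> {x. x \<bullet> \<alpha> = 0}"
        by (rule subset_of_face_of) (use x(1) \<open>x \<in> F\<close> \<open>x \<bullet> \<alpha> = 0\<close> in auto)
      then have "\<alpha> \<bullet> \<beta> = 0" if "\<beta> \<in> R" for \<beta>
        using that hull_inc[of \<beta> R convex] FR by (auto simp: inner_commute)
      moreover have "\<alpha> \<in> span R"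
        using facet_normalD(3)[OF v] \<alpha> \<Delta> span_base by (auto simp: R_def)
      ultimately have "\<alpha> = 0" using span_inner_zero_imp_zero[of \<alpha> R] by blast
      then show False using pos[OF \<alpha>] by simp
    qed
  next
    assume dom: "\<forall>\<alpha>\<in>\<Delta>. \<alpha> \<bullet> v \<ge> 0"
    define b where "b = (1 / real (card R)) *\<^sub>R (\<Sum>x\<in>R. x)"
    have b: "b \<in> rel_interior F"
      unfolding b_def FR by (rule barycenter_in_rel_interior[OF finR Rne])
    have "b \<bullet> \<alpha> \<ge> 0" if \<alpha>: "\<alpha> \<in> \<Delta>" for \<alpha>
    proof (cases "\<alpha> \<bullet> v = 0")
      case False
      then have "\<beta> \<bullet> \<alpha> \<ge> 0" if "\<beta> \<in> R" for \<beta>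
        using root_sign[OF \<alpha> that] dom \<alpha> by (auto simp: zero_le_mult_iff order_less_le)
      then show ?thesis by (simp add: b_def inner_sum_left sum_nonneg)
    next
      case True
      \<comment> \<open>Here \<open>root_sign\<close> gives no information. Instead the reflection
        in \<alpha> permutes \<open>R\<close>, so the barycentre is fixed by it and therefore
        orthogonal to \<alpha>.\<close>
      have into: "root_reflection \<alpha> ` R \<subseteq> R"
        using root_reflection_in[OF rs] \<alpha> \<Delta> True by (auto simp: R_def root_reflection_inner)
      have inj: "inj_on (root_reflection \<alpha>) R"
      proof (rule eq_card_imp_inj_on)
        show "finite R" by (rule finR)
        have "\<alpha> \<in> \<Phi>" using \<alpha> \<Delta> by blast
        then have "root_reflection \<alpha> ` \<Phi> = \<Phi>" using rs by (simp add: root_system_def)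
        then have "inj_on (root_reflection \<alpha>) \<Phi>"
          using root_system_finite[OF rs] by (simp add: eq_card_imp_inj_on)
        then have "inj_on (root_reflection \<alpha>) R" by (rule inj_on_subset) (auto simp: R_def)
        then show "card (root_reflection \<alpha> ` R) = card R" by (rule card_image)
      qed
      have "root_reflection \<alpha> ` R = R" using endo_inj_surj[OF finR into inj] .
      then have "(\<Sum>\<beta>\<in>R. \<beta> \<bullet> \<alpha>) = (\<Sum>\<beta>\<in>R. root_reflection \<alpha> \<beta> \<bullet> \<alpha>)"
        using sum.reindex[OF inj, of "\<lambda>\<beta>. \<beta> \<bullet> \<alpha>"] by simp
      also have "\<dots> = - (\<Sum>\<beta>\<in>R. \<beta> \<bullet> \<alpha>)"
        using pos[OF \<alpha>] by (simp add: root_reflection_inner sum_negf)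
      finally show ?thesis by (simp add: b_def inner_sum_left)
    qed
    moreover have "b \<in> span \<Phi>"
      unfolding b_def by (intro span_scale span_sum span_base) (auto simp: R_def)
    ultimately have "b \<in> fundamental_chamber \<Phi> \<Delta>" by (simp add: fundamental_chamber_def)
    then show "standard_face (root_polytope \<Phi>) (fundamental_chamber \<Phi> \<Delta>) F"
      using b facet by (auto simp: standard_face_def facet_of_def)
  qed
qed

text \<open>Any other pair \<open>w\<close>, \<open>c\<close> has \<open>w\<close> constant on the
  tight roots. These span, so \<open>c = 0\<close> would give \<open>w = 0\<close>, and otherwise
  \<open>w\<close> divided by \<open>c\<close> is the normal \<open>v\<close>. This yields
  uniqueness of the supporting hyperplane as well as its existence.\<close>

lemma supporting_hyperplane_iff:
  assumes rs: "root_system \<Phi>" and v: "facet_normal \<Phi> v"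
    and F: "F = root_polytope \<Phi> \<inter> {x. x \<bullet> v = 1}"
  shows "supporting_hyperplane (span \<Phi>) (root_polytope \<Phi>) F H \<longleftrightarrow> H = {x \<in> span \<Phi>. x \<bullet> v = 1}"
proof
  define R where "R = {\<beta>\<in>\<Phi>. \<beta> \<bullet> v = 1}"
  assume "supporting_hyperplane (span \<Phi>) (root_polytope \<Phi>) F H"
  then obtain w c where w: "w \<in> span \<Phi>" "w \<noteq> 0" and H: "H = {x \<in> span \<Phi>. x \<bullet> w = c}"
    and FH: "F = root_polytope \<Phi> \<inter> H"
    unfolding supporting_hyperplane_def by blast
  have Rc: "\<beta> \<bullet> w = c" if "\<beta> \<in> R" for \<beta>
  proof -
    have "\<beta> \<in> F" using that hull_inc[of \<beta> \<Phi> convex] by (simp add: F R_def root_polytope_def)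
    then show ?thesis using FH H by blast
  qed
  have "c \<noteq> 0"
  proof
    assume "c = 0"
    moreover have "w \<in> span R" using w(1) facet_normalD(3)[OF v] by (simp add: R_def)
    ultimately have "w = 0"
      using Rc span_inner_zero_imp_zero[of w R] by (auto simp: inner_commute)
    then show False using w by simp
  qed
  then have "(1 / c) *\<^sub>R w = v"
    using Rc by (intro facet_normal_eqI[OF v]) (auto simp: span_scale w R_def)
  then have "x \<bullet> w = c \<longleftrightarrow> x \<bullet> v = 1" for x
    using \<open>c \<noteq> 0\<close> by (auto simp: field_simps)
  then show "H = {x \<in> span \<Phi>. x \<bullet> v = 1}" by (simp add: H)
next
  assume H: "H = {x \<in> span \<Phi>. x \<bullet> v = 1}"
  have "v \<noteq> 0" using facet_normal_roots_nonempty[OF rs v] by auto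
  moreover have "\<forall>x\<in>root_polytope \<Phi>. x \<bullet> v \<le> 1"
    using inner_le_convex_hull[OF facet_normalD(2)[OF v]] by (auto simp: root_polytope_def)
  moreover have "F = root_polytope \<Phi> \<inter> H"
    unfolding F H root_polytope_def using convex_hull_subset_span by blast
  ultimately show "supporting_hyperplane (span \<Phi>) (root_polytope \<Phi>) F H"
    unfolding supporting_hyperplane_def using H facet_normalD(1)[OF v] by blast
qed


subsection \<open>Standard facets in the irreducible case\<close>

lemma linear_root_reflection_span:
  assumes "x \<in> span R" "\<And>\<beta>. \<beta> \<in> R \<Longrightarrow> root_reflection \<alpha> \<beta> \<in> R"
  shows "root_reflection \<alpha> x \<in> span R"
proof -
  have "root_reflection \<alpha> x \<in> span (root_reflection \<alpha> ` R)"
    using assms(1) linear_span_image[OF linear_root_reflection] by blast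
  moreover have "root_reflection \<alpha> ` R \<subseteq> R" using assms(2) by blast
  ultimately show ?thesis using span_mono by blast
qed

lemma dynkin_edges_sym: "(u, v) \<in> dynkin_edges V \<longleftrightarrow> (v, u) \<in> dynkin_edges V"
  by (auto simp: dynkin_edges_def inner_commute)

context irreducible_based_root_system
begin

lemma scaled_coweight_dominant:
  assumes "\<alpha> \<in> \<Delta>" "\<gamma> \<in> \<Delta>"
  shows "\<gamma> \<bullet> \<o> \<alpha> \<ge> 0"
  using highest_coeff_pos[OF assms(1)]
  by (simp add: inner_scaled_coweight assms simple_inner_coweight)

lemma root_inner_scaled_coweight_le:
  assumes "\<beta> \<in> \<Phi>" "\<alpha> \<in> \<Delta>"
  shows "\<beta> \<bullet> \<o> \<alpha> \<le> 1"
  using highest_coeff_pos[OF assms(2)] coeff_le_highest[OF assms]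
  by (simp add: inner_scaled_coweight assms)

text \<open>No convex combination has to be formed. Take any \<alpha> with positive inner product
  with \<open>v\<close>, and a tight root \<beta>: the difference of \<theta> and \<beta> has
  nonnegative coefficients, but its inner product with \<open>v\<close> is at most 0. So each term
  vanishes, and at \<alpha> this says that \<beta> has the maximal coefficient. Hence \<beta> is
  tight for \<open>\<o> \<alpha>\<close> too.\<close>

lemma dominant_facet_normal:
  assumes v: "facet_normal \<Phi> v" and dom: "\<forall>\<gamma>\<in>\<Delta>. \<gamma> \<bullet> v \<ge> 0"
  obtains \<alpha> where "\<alpha> \<in> \<Delta>" "v = \<o> \<alpha>"
proof -
  obtain \<beta>0 where \<beta>0: "\<beta>0 \<in> \<Phi>" "\<beta>0 \<bullet> v = 1"
    using facet_normal_roots_nonempty[OF root_system v] by blast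
  have "\<exists>\<alpha>\<in>\<Delta>. \<alpha> \<bullet> v \<noteq> 0"
  proof (rule ccontr)
    assume "\<not> ?thesis"
    then have "\<beta>0 \<bullet> v = 0" using inner_expansion[OF root_in_span[OF \<beta>0(1)], of v] by simp
    then show False using \<beta>0 by simp
  qed
  then obtain \<alpha> where \<alpha>: "\<alpha> \<in> \<Delta>" "\<alpha> \<bullet> v > 0" using dom by (metis order_less_le)
  have "\<o> \<alpha> = v"
  proof (rule facet_normal_eqI[OF v])
    show "\<o> \<alpha> \<in> span \<Phi>" using scaled_coweight_in_span simple_span by blast
    fix \<beta> assume \<beta>: "\<beta> \<in> \<Phi>" "\<beta> \<bullet> v = 1"
    have d: "\<theta> - \<beta> \<in> span \<Delta>" by (intro span_diff root_in_span highest_root_in \<beta>)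
    have nn: "((\<theta> - \<beta>) \<bullet> \<omega> \<gamma>) * (\<gamma> \<bullet> v) \<ge> 0" if "\<gamma> \<in> \<Delta>" for \<gamma>
      using coeff_le_highest[OF \<beta>(1) that] dom that by (simp add: inner_diff_left)
    have "(\<theta> - \<beta>) \<bullet> v \<le> 0"
      using facet_normalD(2)[OF v highest_root_in] \<beta>(2) by (simp add: inner_diff_left)
    then have "(\<Sum>\<gamma>\<in>\<Delta>. ((\<theta> - \<beta>) \<bullet> \<omega> \<gamma>) * (\<gamma> \<bullet> v)) \<le> 0"
      using inner_expansion[OF d, of v] by linarith
    then have z: "(\<Sum>\<gamma>\<in>\<Delta>. ((\<theta> - \<beta>) \<bullet> \<omega> \<gamma>) * (\<gamma> \<bullet> v)) = 0"
      using nn by (intro antisym sum_nonneg)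
    have "\<forall>\<gamma>\<in>\<Delta>. ((\<theta> - \<beta>) \<bullet> \<omega> \<gamma>) * (\<gamma> \<bullet> v) = 0"
      by (rule sum_nonneg_eq_0_iff[OF finite_simple, THEN iffD1]) (use nn z in auto)
    then have "((\<theta> - \<beta>) \<bullet> \<omega> \<alpha>) * (\<alpha> \<bullet> v) = 0" using \<alpha>(1) by blast
    then show "\<beta> \<bullet> \<o> \<alpha> = 1"
      using \<alpha> by (simp add: inner_scaled_coweight_eq_1 inner_diff_left)
  qed
  then show thesis using that \<alpha>(1) by blast
qed

text \<open>Keeps the affine vertex in the diagram when a simple root is deleted.\<close>

lemma minus_highest_not_simple: "- \<theta> \<notin> \<Delta>"
proof
  assume *: "- \<theta> \<in> \<Delta>"
  show False
    using highest_coeff_pos[OF *] simple_inner_coweight[OF *, of "- \<theta>"] by simp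
qed

lemma extended_simple_roots_eq: "extended_simple_roots \<Delta> \<Phi> = insert (- \<theta>) \<Delta>"
  using simple_subset by (auto simp: extended_simple_roots_def)

lemma facet_normal_if_extremal:
  assumes ext: "extremal_root \<Delta> \<Phi> \<alpha>"
  shows "facet_normal \<Phi> (\<o> \<alpha>)"
proof -
  define V where "V = insert (- \<theta>) \<Delta> - {\<alpha>}"
  define R where "R = {\<beta>\<in>\<Phi>. \<beta> \<bullet> \<o> \<alpha> = 1}"
  have \<alpha>: "\<alpha> \<in> \<Delta>" using ext by (simp add: extremal_root_def)
  have conn: "dynkin_connected V"
    using ext by (simp add: extremal_root_def extremal_subset_def extended_simple_roots_eq V_def)
  have \<theta>V: "- \<theta> \<in> V" using \<alpha> minus_highest_not_simple by (auto simp: V_def)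
  have \<theta>R: "\<theta> \<in> R" by (simp add: R_def highest_root_in inner_scaled_coweight_eq_1 \<alpha>)
  \<comment> \<open>Reflection in \<gamma> alters only the coefficient at \<gamma>, while membership
    in \<open>R\<close> is a condition on the coefficient at \<alpha>.\<close>
  have reflR: "root_reflection \<gamma> \<beta> \<in> R" if "\<gamma> \<in> \<Delta>" "\<gamma> \<noteq> \<alpha>" "\<beta> \<in> R" for \<gamma> \<beta>
    using that root_reflection_in[OF root_system simple_in] \<alpha>
    by (simp add: R_def inner_scaled_coweight_eq_1 reflection_coeff)
  have reach: "u \<in> span R" if "(- \<theta>, u) \<in> (dynkin_edges V)\<^sup>*" for u
    using that
  proof (induction rule: rtrancl_induct)
    case base
    then show ?case using \<theta>R by (simp add: span_neg span_base)
  next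
    case (step u w)
    have uw: "w \<in> V" "u \<bullet> w \<noteq> 0" using step(2) by (auto simp: dynkin_edges_def)
    show ?case
    proof (cases "w = - \<theta>")
      case True
      then show ?thesis using \<theta>R by (simp add: span_neg span_base)
    next
      case False
      then have w: "w \<in> \<Delta>" "w \<noteq> \<alpha>" using uw by (auto simp: V_def)
      define c where "c = 2 * (u \<bullet> w) / (w \<bullet> w)"
      have "root_reflection w u \<in> span R"
        using linear_root_reflection_span[OF step.IH] reflR[OF w] by blast
      \<comment> \<open>This difference is a multiple of \<open>w\<close>, and the multiple is
        nonzero exactly because \<open>u\<close> and \<open>w\<close> are joined.\<close>
      then have "u - root_reflection w u \<in> span R" using step.IH by (rule span_diff[rotated])
      moreover have "u - root_reflection w u = c *\<^sub>R w" by (simp add: root_reflection_def c_def)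
      ultimately have "(1 / c) *\<^sub>R (c *\<^sub>R w) \<in> span R" using span_scale by metis
      moreover have "c \<noteq> 0" using uw simple_nonzero[OF w(1)] by (simp add: c_def)
      ultimately show ?thesis by simp
    qed
  qed
  have other: "\<gamma> \<in> span R" if "\<gamma> \<in> \<Delta>" "\<gamma> \<noteq> \<alpha>" for \<gamma>
    using conn \<theta>V that reach by (simp add: dynkin_connected_def V_def)
  \<comment> \<open>The walk avoids the deleted vertex \<alpha>. It is recovered from \<theta>,
    whose coefficient at \<alpha> is positive, by subtracting the other terms.\<close>
  have "\<theta> - (\<Sum>\<gamma>\<in>\<Delta> - {\<alpha>}. (\<theta> \<bullet> \<omega> \<gamma>) *\<^sub>R \<gamma>) \<in> span R"
    using \<theta>R other by (intro span_diff span_sum span_scale) (auto simp: span_base)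
  moreover have "\<theta> = (\<theta> \<bullet> \<omega> \<alpha>) *\<^sub>R \<alpha> + (\<Sum>\<gamma>\<in>\<Delta> - {\<alpha>}. (\<theta> \<bullet> \<omega> \<gamma>) *\<^sub>R \<gamma>)"
    using simple_expansion[OF root_in_span[OF highest_root_in]]
      sum.remove[OF finite_simple \<alpha>, of "\<lambda>\<gamma>. (\<theta> \<bullet> \<omega> \<gamma>) *\<^sub>R \<gamma>"] by argo
  ultimately have "(\<theta> \<bullet> \<omega> \<alpha>) *\<^sub>R \<alpha> \<in> span R" by (metis add_diff_cancel_right')
  then have "(1 / (\<theta> \<bullet> \<omega> \<alpha>)) *\<^sub>R ((\<theta> \<bullet> \<omega> \<alpha>) *\<^sub>R \<alpha>) \<in> span R" by (rule span_scale)
  then have "\<alpha> \<in> span R" using highest_coeff_pos[OF \<alpha>] by simp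
  then have "\<Delta> \<subseteq> span R" using other by blast
  then have "span \<Phi> \<subseteq> span R" using simple_span span_minimal subspace_span by metis
  moreover have "span R \<subseteq> span \<Phi>" by (rule span_mono) (auto simp: R_def)
  ultimately show ?thesis
    using scaled_coweight_in_span simple_span root_inner_scaled_coweight_le[OF _ \<alpha>]
    by (auto simp: facet_normal_def R_def)
qed

text \<open>
  The same argument as for \<open>positive_split\<close>, applied to the part \<open>z\<close> of \<open>\<theta> - x\<close> supported on \<open>B\<close> for a
  counterexample \<open>x\<close> of maximal height.
\<close>

lemma coeff_maximal_on_separated_part:
  assumes B: "B \<subseteq> \<Delta>" and \<theta>B: "\<And>b. b \<in> B \<Longrightarrow> \<theta> \<bullet> b = 0"
    and \<alpha>: "\<alpha> \<in> \<Delta>" "\<alpha> \<notin> B"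
    and AB: "\<And>a b. a \<in> \<Delta> - B - {\<alpha>} \<Longrightarrow> b \<in> B \<Longrightarrow> a \<bullet> b = 0"
    and \<beta>: "\<beta> \<in> \<Phi>" "\<beta> \<bullet> \<omega> \<alpha> = \<theta> \<bullet> \<omega> \<alpha>" and b: "b \<in> B"
  shows "\<beta> \<bullet> \<omega> b = \<theta> \<bullet> \<omega> b"
proof (rule ccontr)
  define M where "M = {x\<in>\<Phi>. x \<bullet> \<omega> \<alpha> = \<theta> \<bullet> \<omega> \<alpha> \<and> (\<exists>b\<in>B. x \<bullet> \<omega> b \<noteq> \<theta> \<bullet> \<omega> b)}"
  assume "\<beta> \<bullet> \<omega> b \<noteq> \<theta> \<bullet> \<omega> b"
  then have "M \<noteq> {}" using \<beta> b by (auto simp: M_def)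
  moreover have "finite M" using root_system_finite[OF root_system] by (simp add: M_def)
  ultimately obtain x where x: "x \<in> M" and xmax: "\<And>y. y \<in> M \<Longrightarrow> \<not> - height y < - height x"
    using ex_is_arg_min_if_finite[of M "\<lambda>x. - height x"] unfolding is_arg_min_def by blast
  have xr: "x \<in> \<Phi>" using x by (simp add: M_def)
  define g where "g \<gamma> = (\<theta> - x) \<bullet> \<omega> \<gamma>" for \<gamma>
  define z where "z = (\<Sum>\<gamma>\<in>B. g \<gamma> *\<^sub>R \<gamma>)"
  have finB: "finite B" using B finite_simple finite_subset by blast
  have g0: "g \<gamma> \<ge> 0" if "\<gamma> \<in> \<Delta>" for \<gamma>
    using coeff_le_highest[OF xr that] by (simp add: g_def inner_diff_left)
  have g\<alpha>: "g \<alpha> = 0" using x by (simp add: g_def M_def inner_diff_left)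
  \<comment> \<open>Since \<open>b\<close> is orthogonal to \<theta> and to all simple roots outside
    \<open>B\<close> except possibly \<alpha>, and since \<open>g \<alpha> = 0\<close>, only the
    terms from \<open>B\<close> remain.\<close>
  have xb: "x \<bullet> b = - (z \<bullet> b)" if "b \<in> B" for b
  proof -
    have "\<theta> - x \<in> span \<Delta>" by (intro span_diff root_in_span highest_root_in xr)
    then have "(\<theta> - x) \<bullet> b = (\<Sum>\<gamma>\<in>\<Delta>. g \<gamma> * (\<gamma> \<bullet> b))" unfolding g_def by (rule inner_expansion)
    also have "\<dots> = (\<Sum>\<gamma>\<in>B. g \<gamma> * (\<gamma> \<bullet> b))"
    proof (rule sum.mono_neutral_right[OF finite_simple B], rule ballI)
      fix \<gamma> assume "\<gamma> \<in> \<Delta> - B"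
      then show "g \<gamma> * (\<gamma> \<bullet> b) = 0" using AB[OF _ that] g\<alpha> by (cases "\<gamma> = \<alpha>") auto
    qed
    also have "\<dots> = z \<bullet> b" by (simp add: z_def inner_sum_left)
    finally show ?thesis using \<theta>B[OF that] by (simp add: inner_diff_left)
  qed
  have "z \<noteq> 0"
  proof
    assume "z = 0"
    obtain b where b: "b \<in> B" "x \<bullet> \<omega> b \<noteq> \<theta> \<bullet> \<omega> b" using x by (auto simp: M_def)
    have "z \<bullet> \<omega> b = (\<Sum>\<gamma>\<in>B. if \<gamma> = b then g \<gamma> else 0)"
      unfolding z_def inner_sum_left
      by (rule sum.cong) (use B in \<open>auto simp: simple_inner_coweight subset_iff\<close>)
    also have "\<dots> = g b" using b finB by simp
    finally show False using b \<open>z = 0\<close> by (simp add: g_def inner_diff_left)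
  qed
  have "(\<Sum>\<gamma>\<in>B. g \<gamma> * (\<gamma> \<bullet> z)) = z \<bullet> z" by (subst (2) z_def) (simp add: inner_sum_left)
  then have "\<not> (\<forall>\<gamma>\<in>B. g \<gamma> * (\<gamma> \<bullet> z) \<le> 0)"
    using \<open>z \<noteq> 0\<close> sum_nonpos[of B "\<lambda>\<gamma>. g \<gamma> * (\<gamma> \<bullet> z)"] by (metis inner_gt_zero_iff not_le)
  then obtain c where c: "c \<in> B" "g c * (c \<bullet> z) > 0" by (auto simp: not_le)
  have c\<Delta>: "c \<in> \<Delta>" and c\<alpha>: "c \<noteq> \<alpha>" using c B \<alpha> by auto
  have zc: "z \<bullet> c > 0" using c g0[OF c\<Delta>] by (auto simp: zero_less_mult_iff inner_commute)
  have cc: "c \<bullet> c > 0" using simple_nonzero[OF c\<Delta>] by simp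
  define n where "n = 2 * (z \<bullet> c) / (c \<bullet> c)"
  define y where "y = root_reflection c x"
  have n: "n > 0" using zc cc by (simp add: n_def)
  have xn: "2 * (x \<bullet> c) / (c \<bullet> c) = - n" by (simp add: xb[OF c(1)] n_def)
  have yc: "y \<bullet> \<omega> \<gamma> = x \<bullet> \<omega> \<gamma> + (if c = \<gamma> then n else 0)" for \<gamma>
    unfolding y_def reflection_coeff[OF c\<Delta>] xn by simp
  have yr: "y \<in> \<Phi>"
    unfolding y_def by (rule root_reflection_in[OF root_system simple_in[OF c\<Delta>] xr])
  have "height y = height x + n" unfolding y_def height_reflection[OF c\<Delta>] xn by simp
  \<comment> \<open>Being higher than \<open>x\<close>, the root \<open>y\<close> is no
    counterexample. Its coefficient at \<alpha> is still maximal because \<open>c\<close> differs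
    from \<alpha>, so it must agree with \<theta> on all of \<open>B\<close>.\<close>
  then have "y \<notin> M" using n xmax[of y] by auto
  then have yB: "\<forall>\<gamma>\<in>B. y \<bullet> \<omega> \<gamma> = \<theta> \<bullet> \<omega> \<gamma>"
    using yr x c\<alpha> by (auto simp: M_def yc)
  have gB: "g \<gamma> = (if \<gamma> = c then n else 0)" if "\<gamma> \<in> B" for \<gamma>
    using yB[rule_format, OF that] by (auto simp: yc g_def inner_diff_left split: if_splits)
  have "z = (\<Sum>\<gamma>\<in>B. if \<gamma> = c then n *\<^sub>R c else 0)"
    unfolding z_def by (rule sum.cong) (auto simp: gB)
  then have "z = n *\<^sub>R c" using finB c by simp
  then have "z \<bullet> c = n * (c \<bullet> c)" by simp
  then have "n = 2 * n" using cc by (simp add: n_def)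
  then show False using n by simp
qed

lemma extremal_if_facet_normal:
  assumes \<alpha>: "\<alpha> \<in> \<Delta>" and v: "facet_normal \<Phi> (\<o> \<alpha>)"
  shows "extremal_root \<Delta> \<Phi> \<alpha>"
proof -
  define V where "V = insert (- \<theta>) \<Delta> - {\<alpha>}"
  define E where "E = (dynkin_edges V)\<^sup>*"
  define B where "B = {u\<in>V. (- \<theta>, u) \<notin> E}"
  have \<theta>V: "- \<theta> \<in> V" using \<alpha> minus_highest_not_simple by (auto simp: V_def)
  have \<theta>E: "(- \<theta>, - \<theta>) \<in> E" by (simp add: E_def)
  have B\<Delta>: "B \<subseteq> \<Delta>" using \<theta>E by (auto simp: B_def V_def)
  have \<alpha>B: "\<alpha> \<notin> B" by (simp add: B_def V_def)
  have orth: "u \<bullet> b = 0" if "u \<in> V" "(- \<theta>, u) \<in> E" "b \<in> B" for u b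
  proof (rule ccontr)
    assume "u \<bullet> b \<noteq> 0"
    moreover have "u \<noteq> b" using that by (auto simp: B_def)
    ultimately have "(u, b) \<in> dynkin_edges V" using that by (simp add: dynkin_edges_def B_def)
    then have "(- \<theta>, b) \<in> E" using that(2) unfolding E_def by (rule rtrancl_into_rtrancl[rotated])
    then show False using that(3) by (simp add: B_def)
  qed
  have "B = {}"
  proof (rule ccontr)
    assume "B \<noteq> {}"
    then obtain b where b: "b \<in> B" by blast
    have b\<Delta>: "b \<in> \<Delta>" using b B\<Delta> by blast
    \<comment> \<open>All tight roots of the facet normal \<open>\<o> \<alpha>\<close> are tight for
      \<open>\<o> b\<close> as well, which determines \<open>\<o> b\<close>; distinct simple roots
      have distinct scaled coweights.\<close>
    have "\<o> b = \<o> \<alpha>"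
    proof (rule facet_normal_eqI[OF v])
      show "\<o> b \<in> span \<Phi>" using scaled_coweight_in_span simple_span by blast
      fix \<beta> assume \<beta>: "\<beta> \<in> \<Phi>" "\<beta> \<bullet> \<o> \<alpha> = 1"
      have "\<beta> \<bullet> \<omega> b = \<theta> \<bullet> \<omega> b"
      proof (rule coeff_maximal_on_separated_part[OF B\<Delta> _ \<alpha> \<alpha>B _ \<beta>(1) _ b])
        show "\<theta> \<bullet> b = 0" if "b \<in> B" for b using orth[OF \<theta>V \<theta>E that] by simp
        show "a \<bullet> b = 0" if "a \<in> \<Delta> - B - {\<alpha>}" "b \<in> B" for a b
          using that by (intro orth) (auto simp: B_def V_def)
        show "\<beta> \<bullet> \<omega> \<alpha> = \<theta> \<bullet> \<omega> \<alpha>" using \<beta> inner_scaled_coweight_eq_1[OF \<alpha>] by blast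
      qed
      then show "\<beta> \<bullet> \<o> b = 1" using inner_scaled_coweight_eq_1[OF b\<Delta>] by blast
    qed
    then have "b = \<alpha>" by (rule scaled_coweight_inj[OF b\<Delta> \<alpha>])
    then show False using b \<alpha>B by blast
  qed
  then have reach: "(- \<theta>, u) \<in> E" if "u \<in> V" for u using that by (auto simp: B_def)
  have "sym E" unfolding E_def by (rule sym_rtrancl) (auto simp: sym_def dynkin_edges_sym)
  then have "(u, w) \<in> E" if "u \<in> V" "w \<in> V" for u w
    using reach[OF that(1)] reach[OF that(2)] unfolding E_def by (meson rtrancl_trans symD)
  then have "dynkin_connected V" using \<theta>V by (auto simp: dynkin_connected_def E_def)
  then show ?thesis
    using \<alpha> simple_subset
    by (auto simp: extremal_root_def extremal_subset_def extended_simple_roots_eq V_def)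
qed

text \<open>Supplies the uniqueness behind the definite description
  \<open>face_simple_roots\<close>: every member of \<open>I\<close> contributes a normal that is
  tight on the whole facet, and a facet has only one.\<close>

lemma facet_simple_roots_unique:
  assumes ext: "extremal_root \<Delta> \<Phi> \<alpha>"
    and F: "F = root_polytope \<Phi> \<inter> {x. x \<bullet> \<o> \<alpha> = 1}"
    and I: "I \<noteq> {}" "I \<subseteq> \<Delta>" "F = {x \<in> root_polytope \<Phi>. \<forall>\<gamma>\<in>I. x \<bullet> \<o> \<gamma> = 1}"
  shows "I = {\<alpha>}"
proof -
  have "\<gamma> = \<alpha>" if \<gamma>: "\<gamma> \<in> I" for \<gamma>
  proof -
    have "\<o> \<gamma> = \<o> \<alpha>"
    proof (rule facet_normal_eqI[OF facet_normal_if_extremal[OF ext]])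
      show "\<o> \<gamma> \<in> span \<Phi>" using scaled_coweight_in_span simple_span by blast
      fix \<beta> assume "\<beta> \<in> \<Phi>" "\<beta> \<bullet> \<o> \<alpha> = 1"
      then have "\<beta> \<in> F" by (simp add: F root_polytope_def hull_inc)
      then show "\<beta> \<bullet> \<o> \<gamma> = 1" using I(3) \<gamma> by blast
    qed
    moreover have "\<gamma> \<in> \<Delta>" "\<alpha> \<in> \<Delta>" using I \<gamma> ext by (auto simp: extremal_root_def)
    ultimately show ?thesis using scaled_coweight_inj by blast
  qed
  then show ?thesis using I(1) by blast
qed

end


subsection \<open>Decomposition into irreducible components\<close>

lemma irreducible_componentD:
  assumes "\<Psi> \<in> irreducible_components \<Phi>"
  shows "\<Psi> \<subseteq> \<Phi>" "irreducible_root_system \<Psi>" "root_system \<Psi>"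
    "\<And>\<alpha> \<beta>. \<alpha> \<in> \<Psi> \<Longrightarrow> \<beta> \<in> \<Phi> - \<Psi> \<Longrightarrow> \<alpha> \<bullet> \<beta> = 0"
  using assms by (auto simp: irreducible_components_def irreducible_root_system_def)

lemma irreducible_root_system_split:
  assumes "irreducible_root_system \<Psi>" "A \<union> B = \<Psi>" "A \<inter> B = {}"
    "\<And>\<alpha> \<beta>. \<alpha> \<in> A \<Longrightarrow> \<beta> \<in> B \<Longrightarrow> \<alpha> \<bullet> \<beta> = 0"
  shows "A = {} \<or> B = {}"
proof (rule ccontr)
  assume "\<not> ?thesis"
  then have "A \<noteq> {} \<and> B \<noteq> {} \<and> A \<inter> B = {} \<and> A \<union> B = \<Psi> \<and> (\<forall>\<alpha>\<in>A. \<forall>\<beta>\<in>B. \<alpha> \<bullet> \<beta> = 0)"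
    using assms(2-4) by simp
  then have "\<exists>A B. A \<noteq> {} \<and> B \<noteq> {} \<and> A \<inter> B = {} \<and> A \<union> B = \<Psi> \<and> (\<forall>\<alpha>\<in>A. \<forall>\<beta>\<in>B. \<alpha> \<bullet> \<beta> = 0)"
    by (intro exI)
  then show False using assms(1) unfolding irreducible_root_system_def by (elim conjE notE)
qed

text \<open>If \<open>X\<close> meets \<open>Y\<close>, then \<open>X \<inter> Y\<close> and
  \<open>X - Y\<close> are orthogonal parts of \<open>X\<close>, because \<open>Y\<close> is
  orthogonal to the rest of \<Phi>. Irreducibility of \<open>X\<close> empties the second part, and
  the roles can be exchanged.\<close>

lemma irreducible_components_eq_or_disjoint:
  assumes \<Psi>: "\<Psi> \<in> irreducible_components \<Phi>" and \<Psi>': "\<Psi>' \<in> irreducible_components \<Phi>"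
    and ne: "\<Psi> \<noteq> \<Psi>'"
  shows "\<Psi> \<inter> \<Psi>' = {}"
proof (rule ccontr)
  assume meet: "\<Psi> \<inter> \<Psi>' \<noteq> {}"
  have sub: "X \<subseteq> Y" if X: "X \<in> irreducible_components \<Phi>" and Y: "Y \<in> irreducible_components \<Phi>"
    and XY: "X \<inter> Y \<noteq> {}" for X Y
  proof -
    have "X \<inter> Y = {} \<or> X - Y = {}"
    proof (rule irreducible_root_system_split[OF irreducible_componentD(2)[OF X]])
      show "\<alpha> \<bullet> \<beta> = 0" if "\<alpha> \<in> X \<inter> Y" "\<beta> \<in> X - Y" for \<alpha> \<beta>
        using that irreducible_componentD(1)[OF X] irreducible_componentD(4)[OF Y, of \<alpha> \<beta>] by blast
    qed auto
    then show ?thesis using XY by blast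
  qed
  have "\<Psi> = \<Psi>'" using sub[OF \<Psi> \<Psi>'] sub[OF \<Psi>' \<Psi>] meet by blast
  then show False using ne by blast
qed

lemma irreducible_components_orthogonal:
  assumes "\<Psi> \<in> irreducible_components \<Phi>" "\<Psi>' \<in> irreducible_components \<Phi>" "\<Psi> \<noteq> \<Psi>'"
    "\<alpha> \<in> \<Psi>" "\<beta> \<in> \<Psi>'"
  shows "\<alpha> \<bullet> \<beta> = 0"
  using irreducible_components_eq_or_disjoint[OF assms(1-3)] assms(4,5)
    irreducible_componentD(1)[OF assms(2)] irreducible_componentD(4)[OF assms(1), of \<alpha> \<beta>] by blast

text \<open>The component is the smallest set of roots that contains \<alpha> and is orthogonal to
  its complement. An orthogonal splitting would make the part containing \<alpha> a smaller such
  set.\<close>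

lemma root_in_irreducible_component:
  assumes rs: "root_system \<Phi>" and \<alpha>: "\<alpha> \<in> \<Phi>"
  obtains \<Psi> where "\<Psi> \<in> irreducible_components \<Phi>" "\<alpha> \<in> \<Psi>"
proof -
  define S where "S = {X. X \<subseteq> \<Phi> \<and> \<alpha> \<in> X \<and> (\<forall>x\<in>X. \<forall>y\<in>\<Phi> - X. x \<bullet> y = 0)}"
  have fin: "finite \<Phi>" by (rule root_system_finite[OF rs])
  have "finite S" by (rule finite_subset[of _ "Pow \<Phi>"]) (auto simp: S_def fin)
  moreover have "\<Phi> \<in> S" using \<alpha> by (simp add: S_def)
  ultimately obtain X where X: "X \<in> S" and Xmin: "\<And>Y. Y \<in> S \<Longrightarrow> \<not> card Y < card X"
    using ex_is_arg_min_if_finite[of S card] unfolding is_arg_min_def by blast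
  have X\<Phi>: "X \<subseteq> \<Phi>" and \<alpha>X: "\<alpha> \<in> X" and orth: "\<And>x y. x \<in> X \<Longrightarrow> y \<in> \<Phi> - X \<Longrightarrow> x \<bullet> y = 0"
    using X by (auto simp: S_def)
  have finX: "finite X" using X\<Phi> fin finite_subset by blast
  have refl_in: "root_reflection x y \<in> X" if "x \<in> X" "y \<in> X" for x y
  proof (rule ccontr)
    assume out: "root_reflection x y \<notin> X"
    have x0: "x \<bullet> x \<noteq> 0" using that X\<Phi> root_system_nonzero[OF rs] by auto
    have "root_reflection x y \<in> \<Phi>" using root_reflection_in[OF rs] that X\<Phi> by blast
    \<comment> \<open>A reflection negates the inner product with its root, so \<open>y\<close> is
      orthogonal to \<open>x\<close> too and is fixed, hence never left \<open>X\<close>.\<close>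
    then have "root_reflection x y \<bullet> x = 0"
      using orth[OF that(1), of "root_reflection x y"] out by (simp add: inner_commute)
    then have "y \<bullet> x = 0" using x0 by (simp add: root_reflection_inner)
    then have "root_reflection x y = y" by (simp add: root_reflection_def)
    then show False using out that by simp
  qed
  have "root_reflection x ` X = X" if "x \<in> X" for x
  proof (rule endo_inj_surj[OF finX])
    show "root_reflection x ` X \<subseteq> X" using refl_in that by blast
    have "root_reflection x ` \<Phi> = \<Phi>" using rs that X\<Phi> unfolding root_system_def by blast
    then have "inj_on (root_reflection x) \<Phi>" using fin by (simp add: eq_card_imp_inj_on)
    then show "inj_on (root_reflection x) X" using X\<Phi> by (rule inj_on_subset)
  qed
  moreover have "\<forall>x\<in>X. \<forall>y\<in>X. 2 * (y \<bullet> x) / (x \<bullet> x) \<in> \<int>"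
    and "\<forall>x\<in>X. \<forall>c. c *\<^sub>R x \<in> X \<longrightarrow> c = 1 \<or> c = -1" and "0 \<notin> X"
    using rs X\<Phi> unfolding root_system_def by (meson subsetD)+
  ultimately have rsX: "root_system X"
    using \<alpha>X finX unfolding root_system_def by blast
  have "\<not> (\<exists>A B. A \<noteq> {} \<and> B \<noteq> {} \<and> A \<inter> B = {} \<and> A \<union> B = X \<and> (\<forall>x\<in>A. \<forall>y\<in>B. x \<bullet> y = 0))"
  proof (intro notI, elim exE conjE)
    fix A B
    assume AB: "A \<noteq> {}" "B \<noteq> {}" "A \<inter> B = {}" "A \<union> B = X" and o: "\<forall>x\<in>A. \<forall>y\<in>B. x \<bullet> y = 0"
    have part: False if CD: "C \<inter> D = {}" "C \<union> D = X" "D \<noteq> {}" "\<alpha> \<in> C"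
      and CDo: "\<And>x y. x \<in> C \<Longrightarrow> y \<in> D \<Longrightarrow> x \<bullet> y = 0" for C D
    proof -
      have "x \<bullet> y = 0" if "x \<in> C" "y \<in> \<Phi> - C" for x y
      proof (cases "y \<in> D")
        case True
        then show ?thesis using CDo that by blast
      next
        case False
        then show ?thesis using orth[of x y] that CD(2) by blast
      qed
      then have "C \<in> S" using CD X\<Phi> by (auto simp: S_def)
      moreover have "card C < card X" using CD finX by (intro psubset_card_mono) auto
      ultimately show False using Xmin by blast
    qed
    show False
    proof (cases "\<alpha> \<in> A")
      case True
      then show False using part[of A B] AB o by blast
    next
      case False
      then have "\<alpha> \<in> B" using \<alpha>X AB by blast
      moreover have "x \<bullet> y = 0" if "x \<in> B" "y \<in> A" for x y
        using o that inner_commute[of x y] by auto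
      ultimately show False using part[of B A] AB by blast
    qed
  qed
  then have "irreducible_root_system X" using rsX by (simp add: irreducible_root_system_def)
  then have "X \<in> irreducible_components \<Phi>" using X\<Phi> orth by (simp add: irreducible_components_def)
  then show thesis using that \<alpha>X by blast
qed

text \<open>The family \<open>w\<close> is a parameter because the two uses run in opposite
  directions: projections of a given normal, and a sum assembled from given component
  normals.\<close>

lemma facet_normal_components:
  assumes rs: "root_system \<Phi>" and v: "v \<in> span \<Phi>"
    and w: "\<And>\<Psi>. \<Psi> \<in> irreducible_components \<Phi> \<Longrightarrow> w \<Psi> \<in> span \<Psi>"
      "\<And>\<Psi> \<beta>. \<Psi> \<in> irreducible_components \<Phi> \<Longrightarrow> \<beta> \<in> \<Psi> \<Longrightarrow> \<beta> \<bullet> v = \<beta> \<bullet> w \<Psi>"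
  shows "facet_normal \<Phi> v \<longleftrightarrow> (\<forall>\<Psi>\<in>irreducible_components \<Phi>. facet_normal \<Psi> (w \<Psi>))"
proof
  define R where "R = {\<beta>\<in>\<Phi>. \<beta> \<bullet> v = 1}"
  assume fn: "facet_normal \<Phi> v"
  show "\<forall>\<Psi>\<in>irreducible_components \<Phi>. facet_normal \<Psi> (w \<Psi>)"
  proof
    fix \<Psi> assume \<Psi>: "\<Psi> \<in> irreducible_components \<Phi>"
    define A where "A = {\<beta>\<in>\<Psi>. \<beta> \<bullet> w \<Psi> = 1}"
    \<comment> \<open>Tight roots outside \<Psi> are orthogonal to \<Psi>, so only those in
      \<open>A\<close> help to span it.\<close>
    have "R \<subseteq> A \<union> (\<Phi> - \<Psi>)" using w(2)[OF \<Psi>] by (auto simp: R_def A_def)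
    then have "span \<Phi> \<subseteq> span (A \<union> (\<Phi> - \<Psi>))"
      using facet_normalD(3)[OF fn] span_mono unfolding R_def by blast
    then have "\<beta> \<in> span A" if "\<beta> \<in> \<Psi>" for \<beta>
      using that irreducible_componentD(1,4)[OF \<Psi>]
      by (intro orthogonal_component_span[of \<beta> A "\<Phi> - \<Psi>" \<Psi>]) (auto simp: A_def span_base subset_iff)
    then have "span \<Psi> \<subseteq> span A" by (intro span_minimal) auto
    moreover have "span A \<subseteq> span \<Psi>" by (rule span_mono) (auto simp: A_def)
    ultimately have "span A = span \<Psi>" by blast
    moreover have "\<beta> \<bullet> w \<Psi> \<le> 1" if "\<beta> \<in> \<Psi>" for \<beta>
      using that w(2)[OF \<Psi> that] facet_normalD(2)[OF fn] irreducible_componentD(1)[OF \<Psi>]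
      by (metis subsetD)
    ultimately show "facet_normal \<Psi> (w \<Psi>)" using w(1)[OF \<Psi>] by (simp add: facet_normal_def A_def)
  qed
next
  define R where "R = {\<beta>\<in>\<Phi>. \<beta> \<bullet> v = 1}"
  assume fn: "\<forall>\<Psi>\<in>irreducible_components \<Phi>. facet_normal \<Psi> (w \<Psi>)"
  have "\<beta> \<bullet> v \<le> 1 \<and> \<beta> \<in> span R" if "\<beta> \<in> \<Phi>" for \<beta>
  proof -
    obtain \<Psi> where \<Psi>: "\<Psi> \<in> irreducible_components \<Phi>" "\<beta> \<in> \<Psi>"
      by (rule root_in_irreducible_component[OF rs \<open>\<beta> \<in> \<Phi>\<close>])
    have f: "facet_normal \<Psi> (w \<Psi>)" using fn \<Psi> by blast
    have "{\<beta>\<in>\<Psi>. \<beta> \<bullet> w \<Psi> = 1} \<subseteq> R"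
      using irreducible_componentD(1)[OF \<Psi>(1)] w(2)[OF \<Psi>(1)] by (auto simp: R_def)
    then have "span \<Psi> \<subseteq> span R" using span_mono facet_normalD(3)[OF f] by metis
    then show ?thesis using facet_normalD(2)[OF f] w(2)[OF \<Psi>] \<Psi>(2) span_base by fastforce
  qed
  then have "span \<Phi> \<subseteq> span R" by (intro span_minimal) auto
  moreover have "span R \<subseteq> span \<Phi>" by (rule span_mono) (auto simp: R_def)
  ultimately show "facet_normal \<Phi> v"
    using v \<open>\<And>\<beta>. \<beta> \<in> \<Phi> \<Longrightarrow> \<beta> \<bullet> v \<le> 1 \<and> \<beta> \<in> span R\<close> by (auto simp: facet_normal_def R_def)
qed

lemma span_projection:
  fixes v :: "'a::euclidean_space"
  obtains w where "w \<in> span S" "\<And>x. x \<in> span S \<Longrightarrow> x \<bullet> v = x \<bullet> w"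
proof -
  obtain w z where w: "w \<in> span S" and z: "\<And>x. x \<in> span S \<Longrightarrow> orthogonal z x" and v: "v = w + z"
    by (rule orthogonal_subspace_decomp_exists[of S v]) metis
  have "x \<bullet> v = x \<bullet> w" if "x \<in> span S" for x
    using z[OF that] by (simp add: v inner_add_right orthogonal_def inner_commute)
  then show thesis using that w by blast
qed

lemma inner_span_eq:
  assumes "\<And>\<beta>. \<beta> \<in> S \<Longrightarrow> \<beta> \<bullet> v = \<beta> \<bullet> w" "x \<in> span S"
  shows "x \<bullet> v = x \<bullet> w"
proof -
  have "orthogonal (v - w) x"
    by (rule orthogonal_to_span[OF assms(2)])
       (simp add: orthogonal_def inner_diff_left assms(1) inner_commute[of v] inner_commute[of w])
  then show ?thesis
    by (simp add: orthogonal_def inner_diff_left inner_commute[of v] inner_commute[of w])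
qed

lemma component_slice:
  assumes \<Psi>: "\<Psi> \<in> irreducible_components \<Phi>"
    and w: "\<And>\<beta>. \<beta> \<in> \<Psi> \<Longrightarrow> \<beta> \<bullet> v = \<beta> \<bullet> w"
  shows "root_polytope \<Phi> \<inter> {x. x \<bullet> v = 1} \<inter> span \<Psi> = root_polytope \<Psi> \<inter> {x. x \<bullet> w = 1}"
proof -
  have "root_polytope \<Psi> = root_polytope \<Phi> \<inter> span \<Psi>"
    using component_polytope_eq_root_polytope[OF \<Psi>] by (simp add: component_polytope_def)
  then show ?thesis using inner_span_eq[OF w] by auto
qed

section \<open>Base, coweights and chamber inherited by a component\<close>

context based_root_system
begin

text \<open>In the expansion of a root of \<Psi>, the simple roots outside \<Psi> are orthogonal to
  \<Psi> and drop out.\<close>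

lemma component_simple_span:
  assumes \<Psi>: "\<Psi> \<in> irreducible_components \<Phi>"
  shows "span (\<Delta> \<inter> \<Psi>) = span \<Psi>"
proof
  show "span (\<Delta> \<inter> \<Psi>) \<subseteq> span \<Psi>" by (rule span_mono) blast
  have "\<beta> \<in> span (\<Delta> \<inter> \<Psi>)" if "\<beta> \<in> \<Psi>" for \<beta>
  proof (rule orthogonal_component_span[of _ _ "\<Delta> - \<Psi>"])
    have "\<beta> \<in> span \<Delta>" using root_in_span that irreducible_componentD(1)[OF \<Psi>] by blast
    then show "\<beta> \<in> span (\<Delta> \<inter> \<Psi> \<union> (\<Delta> - \<Psi>))" by (simp add: Int_Diff_Un)
    show "s \<bullet> b = 0" if "s \<in> \<Psi>" "b \<in> \<Delta> - \<Psi>" for s b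
      using irreducible_componentD(4)[OF \<Psi> that(1)] that(2) simple_in by blast
  qed (auto simp: that span_base)
  then show "span \<Psi> \<subseteq> span (\<Delta> \<inter> \<Psi>)" by (intro span_minimal) auto
qed

lemma component_based:
  assumes \<Psi>: "\<Psi> \<in> irreducible_components \<Phi>"
  shows "irreducible_based_root_system \<Psi> (\<Delta> \<inter> \<Psi>)"
proof
  show "root_system \<Psi>" "irreducible_root_system \<Psi>" using irreducible_componentD[OF \<Psi>] by auto
  have "representation (\<Delta> \<inter> \<Psi>) \<beta> = representation \<Delta> \<beta>" if "\<beta> \<in> \<Psi>" for \<beta>
    using representation_extend[OF simple_independent, of \<beta> "\<Delta> \<inter> \<Psi>"] component_simple_span[OF \<Psi>]
      span_base[OF that] by simp
  moreover have "(\<forall>\<alpha>\<in>\<Delta>. representation \<Delta> \<beta> \<alpha> \<in> \<nat>) \<or> (\<forall>\<alpha>\<in>\<Delta>. - representation \<Delta> \<beta> \<alpha> \<in> \<nat>)"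
    if "\<beta> \<in> \<Psi>" for \<beta>
    using simple_roots that irreducible_componentD(1)[OF \<Psi>] unfolding simple_roots_def by blast
  moreover have "independent (\<Delta> \<inter> \<Psi>)"
    using simple_independent by (rule independent_mono) blast
  ultimately show "simple_roots \<Psi> (\<Delta> \<inter> \<Psi>)"
    using component_simple_span[OF \<Psi>] unfolding simple_roots_def by auto
qed

text \<open>Links the coweights of the whole base, used in the theorem, with those of the component
  base, used in the irreducible theory. The latter lie in \<open>span \<Psi>\<close>, so they vanish
  on the simple roots of the other components.\<close>

lemma component_scaled_coweight:
  assumes \<Psi>: "\<Psi> \<in> irreducible_components \<Phi>" and \<alpha>: "\<alpha> \<in> \<Delta> \<inter> \<Psi>"
  shows "scaled_coweight (\<Delta> \<inter> \<Psi>) \<Psi> \<alpha> = scaled_coweight \<Delta> \<Psi> \<alpha>"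
proof -
  interpret C: irreducible_based_root_system \<Psi> "\<Delta> \<inter> \<Psi>" by (rule component_based[OF \<Psi>])
  have "coweight \<Delta> \<alpha> = coweight (\<Delta> \<inter> \<Psi>) \<alpha>"
  proof (rule coweight_eqI)
    show "coweight (\<Delta> \<inter> \<Psi>) \<alpha> \<in> span \<Delta>"
      using C.coweight_in_span span_mono[of "\<Delta> \<inter> \<Psi>" \<Delta>] by blast
    show "\<beta> \<bullet> coweight (\<Delta> \<inter> \<Psi>) \<alpha> = (if \<beta> = \<alpha> then 1 else 0)" if \<beta>: "\<beta> \<in> \<Delta>" for \<beta>
    proof (cases "\<beta> \<in> \<Psi>")
      case True
      then show ?thesis using C.simple_inner_coweight \<beta> by simp
    next
      case False
      have "coweight (\<Delta> \<inter> \<Psi>) \<alpha> \<bullet> \<beta> = 0"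
        by (rule span_inner_orthogonal[OF C.coweight_in_span span_base[of \<beta> "{\<beta>}"]])
           (use irreducible_componentD(4)[OF \<Psi>] False \<beta> simple_in in auto)
      then show ?thesis using False \<alpha> by (auto simp: inner_commute)
    qed
  qed
  then show ?thesis by (simp add: scaled_coweight_def highest_root_coeff_def highest_root_def)
qed

lemma component_extremal_subset:
  "extremal_subset (\<Delta> \<inter> \<Psi>) \<Psi> I \<longleftrightarrow> extremal_subset \<Delta> \<Psi> I"
  by (simp add: extremal_subset_def extended_simple_roots_def highest_root_def)

lemma component_extremal_root:
  "extremal_root (\<Delta> \<inter> \<Psi>) \<Psi> \<alpha> \<longleftrightarrow> extremal_root \<Delta> \<Psi> \<alpha>"
  by (simp add: extremal_root_def component_extremal_subset)

text \<open>The inequalities for simple roots outside \<Psi> hold trivially on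
  \<open>span \<Psi>\<close>, as equalities.\<close>

lemma component_chamber_eq:
  assumes \<Psi>: "\<Psi> \<in> irreducible_components \<Phi>"
  shows "component_chamber \<Phi> \<Delta> \<Psi> = fundamental_chamber \<Psi> (\<Delta> \<inter> \<Psi>)"
proof -
  have "x \<bullet> \<alpha> = 0" if "x \<in> span \<Psi>" "\<alpha> \<in> \<Delta> - \<Psi>" for x \<alpha>
    by (rule span_inner_orthogonal[OF that(1) span_base[of \<alpha> "{\<alpha>}"]])
       (use irreducible_componentD(4)[OF \<Psi>] that(2) simple_in in auto)
  moreover have "span \<Psi> \<subseteq> span \<Phi>" using irreducible_componentD(1)[OF \<Psi>] by (rule span_mono)
  ultimately show ?thesis
    unfolding component_chamber_def fundamental_chamber_def by fastforce
qed

lemma component_face_simple_roots: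
  assumes \<Psi>: "\<Psi> \<in> irreducible_components \<Phi>" and ext: "extremal_root \<Delta> \<Psi> \<alpha>"
    and F: "F \<inter> span \<Psi> = root_polytope \<Psi> \<inter> {x. x \<bullet> scaled_coweight \<Delta> \<Psi> \<alpha> = 1}"
  shows "face_simple_roots \<Phi> \<Delta> \<Psi> F = {\<alpha>}"
proof -
  interpret C: irreducible_based_root_system \<Psi> "\<Delta> \<inter> \<Psi>" by (rule component_based[OF \<Psi>])
  have P: "component_polytope \<Phi> \<Psi> = root_polytope \<Psi>" by (rule component_polytope_eq_root_polytope[OF \<Psi>])
  have \<alpha>: "\<alpha> \<in> \<Delta> \<inter> \<Psi>" using ext by (simp add: extremal_root_def)
  show ?thesis
    unfolding face_simple_roots_def P
  proof (rule the_equality)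
    show "{\<alpha>} \<noteq> {} \<and> extremal_subset \<Delta> \<Psi> {\<alpha>} \<and>
      F \<inter> span \<Psi> = {x \<in> root_polytope \<Psi>. \<forall>\<gamma>\<in>{\<alpha>}. x \<bullet> scaled_coweight \<Delta> \<Psi> \<gamma> = 1}"
      using ext F by (auto simp: extremal_root_def)
    fix I assume I: "I \<noteq> {} \<and> extremal_subset \<Delta> \<Psi> I \<and>
      F \<inter> span \<Psi> = {x \<in> root_polytope \<Psi>. \<forall>\<gamma>\<in>I. x \<bullet> scaled_coweight \<Delta> \<Psi> \<gamma> = 1}"
    then have sub: "I \<subseteq> \<Delta> \<inter> \<Psi>" by (simp add: extremal_subset_def)
    have eq: "scaled_coweight (\<Delta> \<inter> \<Psi>) \<Psi> \<gamma> = scaled_coweight \<Delta> \<Psi> \<gamma>" if "\<gamma> \<in> I" for \<gamma>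
      by (rule component_scaled_coweight[OF \<Psi>]) (use that sub in blast)
    show "I = {\<alpha>}"
    proof (rule C.facet_simple_roots_unique[of \<alpha> "F \<inter> span \<Psi>"])
      show "extremal_root (\<Delta> \<inter> \<Psi>) \<Psi> \<alpha>" using ext component_extremal_root by blast
      show "F \<inter> span \<Psi> = root_polytope \<Psi> \<inter> {x. x \<bullet> scaled_coweight (\<Delta> \<inter> \<Psi>) \<Psi> \<alpha> = 1}"
        using F component_scaled_coweight[OF \<Psi> \<alpha>] by simp
      show "I \<noteq> {}" "I \<subseteq> \<Delta> \<inter> \<Psi>" using I sub by auto
      show "F \<inter> span \<Psi> = {x \<in> root_polytope \<Psi>. \<forall>\<gamma>\<in>I. x \<bullet> scaled_coweight (\<Delta> \<inter> \<Psi>) \<Psi> \<gamma> = 1}"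
        using I eq by auto
    qed
  qed
qed

end

lemma sum_components_inner:
  fixes k :: nat
  assumes bij: "bij_betw \<Phi>i {1..k} (irreducible_components \<Phi>)"
    and w: "\<And>i. i \<in> {1..k} \<Longrightarrow> w i \<in> span (\<Phi>i i)" and j: "j \<in> {1..k}" "\<beta> \<in> \<Phi>i j"
  shows "\<beta> \<bullet> (\<Sum>i\<in>{1..k}. w i) = \<beta> \<bullet> w j"
proof -
  have "\<beta> \<bullet> w i = 0" if i: "i \<in> {1..k}" "i \<noteq> j" for i
  proof (rule span_inner_orthogonal[OF span_base[OF j(2)] w[OF i(1)]])
    \<comment> \<open>Distinct indices name distinct components, which are orthogonal, so only the
      summand with index \<open>j\<close> survives.\<close>
    have "\<Phi>i i \<noteq> \<Phi>i j" using bij i j unfolding bij_betw_def inj_on_def by blast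
    moreover have "\<Phi>i i \<in> irreducible_components \<Phi>" "\<Phi>i j \<in> irreducible_components \<Phi>"
      using bij i j bij_betwE by blast+
    ultimately show "a \<bullet> b = 0" if "a \<in> \<Phi>i j" "b \<in> \<Phi>i i" for a b
      using irreducible_components_orthogonal that by metis
  qed
  then have "(\<Sum>i\<in>{1..k}. \<beta> \<bullet> w i) = (\<Sum>i\<in>{1..k}. if i = j then \<beta> \<bullet> w j else 0)"
    by (intro sum.cong) auto
  also have "\<dots> = \<beta> \<bullet> w j" using j(1) by (subst sum.delta) auto
  finally show ?thesis by (simp add: inner_sum_right)
qed

theorem corollary3p12:
  fixes \<Phi> \<Delta> :: "'a::euclidean_space set" and \<Phi>i :: "nat \<Rightarrow> 'a set" and k :: nat
  assumes "root_system \<Phi>"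
    and "simple_roots \<Phi> \<Delta>"
    and "bij_betw \<Phi>i {1..k} (irreducible_components \<Phi>)"
  shows
    "(\<forall>F. F facet_of root_polytope \<Phi> \<longrightarrow>
        (\<forall>i\<in>{1..k}. F \<inter> span (\<Phi>i i) \<noteq> {} \<and>
           aff_dim (F \<inter> span (\<Phi>i i)) = int (dim (span (\<Phi>i i))) - 1) \<and>
        (standard_face (root_polytope \<Phi>) (fundamental_chamber \<Phi> \<Delta>) F \<longleftrightarrow>
           (\<forall>i\<in>{1..k}. standard_facet (component_polytope \<Phi> (\<Phi>i i))
              (component_chamber \<Phi> \<Delta> (\<Phi>i i)) (F \<inter> span (\<Phi>i i)))) \<and>
        (standard_face (root_polytope \<Phi>) (fundamental_chamber \<Phi> \<Delta>) F \<longrightarrow>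
           (\<exists>\<alpha>. (\<forall>i\<in>{1..k}. extremal_root \<Delta> (\<Phi>i i) (\<alpha> i) \<and>
                   face_simple_roots \<Phi> \<Delta> (\<Phi>i i) F = {\<alpha> i} \<and>
                   face_barycenter \<Phi> \<Delta> (\<Phi>i i) F = scaled_coweight \<Delta> (\<Phi>i i) (\<alpha> i)) \<and>
                (\<forall>H. supporting_hyperplane (span \<Phi>) (root_polytope \<Phi>) F H \<longleftrightarrow>
                   H = {x \<in> span \<Phi>. x \<bullet> (\<Sum>i\<in>{1..k}. scaled_coweight \<Delta> (\<Phi>i i) (\<alpha> i)) = 1})))) \<and>
     (\<forall>\<alpha>. (\<forall>i\<in>{1..k}. extremal_root \<Delta> (\<Phi>i i) (\<alpha> i)) \<longrightarrow>
        (\<exists>F. standard_facet (root_polytope \<Phi>) (fundamental_chamber \<Phi> \<Delta>) F \<and>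
           supporting_hyperplane (span \<Phi>) (root_polytope \<Phi>) F
             {x \<in> span \<Phi>. x \<bullet> (\<Sum>i\<in>{1..k}. scaled_coweight \<Delta> (\<Phi>i i) (\<alpha> i)) = 1}))"
proof (intro conjI allI impI)
  interpret based_root_system \<Phi> \<Delta> using assms(1,2) by unfold_locales
  let ?P = "root_polytope \<Phi>" and ?C = "fundamental_chamber \<Phi> \<Delta>"
  have comp: "\<Phi>i i \<in> irreducible_components \<Phi>" if "i \<in> {1..k}" for i
    using assms(3) that bij_betwE by blast
  have comp_ex: "\<exists>i\<in>{1..k}. \<Psi> = \<Phi>i i" if "\<Psi> \<in> irreducible_components \<Phi>" for \<Psi>
    using assms(3) that unfolding bij_betw_def by blast
  have root_ex: "\<exists>i\<in>{1..k}. \<beta> \<in> \<Phi>i i" if \<beta>: "\<beta> \<in> \<Phi>" for \<beta>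
  proof -
    obtain \<Psi> where "\<Psi> \<in> irreducible_components \<Phi>" "\<beta> \<in> \<Psi>"
      by (rule root_in_irreducible_component[OF assms(1) \<beta>])
    then show ?thesis using comp_ex by blast
  qed
  have simple_ex: "\<exists>i\<in>{1..k}. \<gamma> \<in> \<Delta> \<inter> \<Phi>i i" if "\<gamma> \<in> \<Delta>" for \<gamma>
    using root_ex[OF simple_in[OF that]] that by blast
  have span_comp: "span (\<Phi>i i) \<subseteq> span \<Phi>" if "i \<in> {1..k}" for i
    using irreducible_componentD(1)[OF comp[OF that]] by (rule span_mono)
  have coweight_comp: "scaled_coweight \<Delta> (\<Phi>i i) \<alpha> \<in> span (\<Phi>i i)"
    if "i \<in> {1..k}" "\<alpha> \<in> \<Delta> \<inter> \<Phi>i i" for i \<alpha>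
  proof -
    interpret C: irreducible_based_root_system "\<Phi>i i" "\<Delta> \<inter> \<Phi>i i"
      by (rule component_based[OF comp[OF that(1)]])
    show ?thesis
      using C.scaled_coweight_in_span component_scaled_coweight[OF comp[OF that(1)] that(2)]
        C.simple_span by metis
  qed
  {
    fix F assume "F facet_of ?P"
    then obtain v where v: "facet_normal \<Phi> v" and F: "F = ?P \<inter> {x. x \<bullet> v = 1}"
      using facet_of_root_polytope_iff[OF assms(1)] by blast
    \<comment> \<open>The projection exists for every set \<Psi>, so the choice function can be
      taken without restriction to components.\<close>
    have "\<forall>\<Psi>. \<exists>w. w \<in> span \<Psi> \<and> (\<forall>x\<in>span \<Psi>. x \<bullet> v = x \<bullet> w)"
    proof
      fix \<Psi> :: "'a set"
      obtain w where "w \<in> span \<Psi>" "\<And>x. x \<in> span \<Psi> \<Longrightarrow> x \<bullet> v = x \<bullet> w"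
        by (rule span_projection[of \<Psi> v]) blast
      then show "\<exists>w. w \<in> span \<Psi> \<and> (\<forall>x\<in>span \<Psi>. x \<bullet> v = x \<bullet> w)" by blast
    qed
    then have "\<exists>w. \<forall>\<Psi>. w \<Psi> \<in> span \<Psi> \<and> (\<forall>x\<in>span \<Psi>. x \<bullet> v = x \<bullet> w \<Psi>)" by (rule choice)
    then obtain w where w: "\<And>\<Psi>. w \<Psi> \<in> span \<Psi>" "\<And>\<Psi> x. x \<in> span \<Psi> \<Longrightarrow> x \<bullet> v = x \<bullet> w \<Psi>" by blast
    have wb: "\<beta> \<bullet> v = \<beta> \<bullet> w \<Psi>" if "\<beta> \<in> \<Psi>" for \<beta> \<Psi> using w(2) span_base[OF that] by blast
    have fn: "facet_normal (\<Phi>i i) (w (\<Phi>i i))" if "i \<in> {1..k}" for i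
      using facet_normal_components[OF assms(1) facet_normalD(1)[OF v], of w] v w(1) wb comp[OF that]
      by blast
    have slice: "F \<inter> span (\<Phi>i i) = root_polytope (\<Phi>i i) \<inter> {x. x \<bullet> w (\<Phi>i i) = 1}"
      if "i \<in> {1..k}" for i
      unfolding F using component_slice[OF comp[OF that] wb] by simp
    have rsi: "root_system (\<Phi>i i)" if "i \<in> {1..k}" for i
      using irreducible_componentD(3)[OF comp[OF that]] .
    have facet: "F \<inter> span (\<Phi>i i) facet_of root_polytope (\<Phi>i i)" if "i \<in> {1..k}" for i
      using facet_of_root_polytope_iff[OF rsi[OF that]] fn[OF that] slice[OF that] by blast
    show "\<forall>i\<in>{1..k}. F \<inter> span (\<Phi>i i) \<noteq> {} \<and>
           aff_dim (F \<inter> span (\<Phi>i i)) = int (dim (span (\<Phi>i i))) - 1"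
    proof
      fix i assume i: "i \<in> {1..k}"
      show "F \<inter> span (\<Phi>i i) \<noteq> {} \<and>
           aff_dim (F \<inter> span (\<Phi>i i)) = int (dim (span (\<Phi>i i))) - 1"
        using facet[OF i] aff_dim_root_polytope[OF rsi[OF i]] by (simp add: facet_of_def)
    qed
    have dom: "standard_face ?P ?C F \<longleftrightarrow> (\<forall>\<gamma>\<in>\<Delta>. \<gamma> \<bullet> v \<ge> 0)"
      by (rule standard_face_iff_dominant[OF assms(1) simple_subset v F])
    have domi: "standard_facet (component_polytope \<Phi> (\<Phi>i i)) (component_chamber \<Phi> \<Delta> (\<Phi>i i))
        (F \<inter> span (\<Phi>i i)) \<longleftrightarrow> (\<forall>\<gamma>\<in>\<Delta> \<inter> \<Phi>i i. \<gamma> \<bullet> v \<ge> 0)" if i: "i \<in> {1..k}" for i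
      using facet[OF i] wb[of _ "\<Phi>i i"]
        standard_face_iff_dominant[OF rsi[OF i] _ fn[OF i] slice[OF i], of "\<Delta> \<inter> \<Phi>i i"]
      by (simp add: standard_facet_def component_polytope_eq_root_polytope[OF comp[OF i]]
          component_chamber_eq[OF comp[OF i]])
    show "standard_face ?P ?C F \<longleftrightarrow>
           (\<forall>i\<in>{1..k}. standard_facet (component_polytope \<Phi> (\<Phi>i i))
              (component_chamber \<Phi> \<Delta> (\<Phi>i i)) (F \<inter> span (\<Phi>i i)))"
    proof -
      \<comment> \<open>The components cover the base, so dominance of \<open>v\<close> is tested
        one component at a time.\<close>
      have "(\<forall>\<gamma>\<in>\<Delta>. \<gamma> \<bullet> v \<ge> 0) \<longleftrightarrow> (\<forall>i\<in>{1..k}. \<forall>\<gamma>\<in>\<Delta> \<inter> \<Phi>i i. \<gamma> \<bullet> v \<ge> 0)"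
        using simple_ex by blast
      then show ?thesis unfolding dom using domi by simp
    qed
    assume std: "standard_face ?P ?C F"
    have "\<forall>i\<in>{1..k}. \<exists>\<alpha>. extremal_root \<Delta> (\<Phi>i i) \<alpha> \<and> w (\<Phi>i i) = scaled_coweight \<Delta> (\<Phi>i i) \<alpha>"
    proof
      fix i assume i: "i \<in> {1..k}"
      interpret C: irreducible_based_root_system "\<Phi>i i" "\<Delta> \<inter> \<Phi>i i"
        by (rule component_based[OF comp[OF i]])
      have "\<forall>\<gamma>\<in>\<Delta> \<inter> \<Phi>i i. \<gamma> \<bullet> w (\<Phi>i i) \<ge> 0" 
      proof
        fix \<gamma> assume \<gamma>: "\<gamma> \<in> \<Delta> \<inter> \<Phi>i i"
        then have "\<gamma> \<bullet> v \<ge> 0" using std dom by blast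
        then show "\<gamma> \<bullet> w (\<Phi>i i) \<ge> 0" using wb[of \<gamma> "\<Phi>i i"] \<gamma> by simp
      qed
      from C.dominant_facet_normal[OF fn[OF i] this] obtain \<alpha> where \<alpha>: "\<alpha> \<in> \<Delta> \<inter> \<Phi>i i"
        and eq: "w (\<Phi>i i) = scaled_coweight (\<Delta> \<inter> \<Phi>i i) (\<Phi>i i) \<alpha>" by metis
      have "extremal_root \<Delta> (\<Phi>i i) \<alpha>"
        using C.extremal_if_facet_normal[OF \<alpha>] fn[OF i] unfolding eq component_extremal_root by blast
      moreover have "w (\<Phi>i i) = scaled_coweight \<Delta> (\<Phi>i i) \<alpha>"
        unfolding eq by (rule component_scaled_coweight[OF comp[OF i] \<alpha>])
      ultimately show "\<exists>\<alpha>. extremal_root \<Delta> (\<Phi>i i) \<alpha> \<and> w (\<Phi>i i) = scaled_coweight \<Delta> (\<Phi>i i) \<alpha>"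
        by blast
    qed
    from bchoice[OF this] obtain \<alpha> where ext: "\<And>i. i \<in> {1..k} \<Longrightarrow> extremal_root \<Delta> (\<Phi>i i) (\<alpha> i)"
      and eq: "\<And>i. i \<in> {1..k} \<Longrightarrow> w (\<Phi>i i) = scaled_coweight \<Delta> (\<Phi>i i) (\<alpha> i)" by blast
    have roots: "face_simple_roots \<Phi> \<Delta> (\<Phi>i i) F = {\<alpha> i}" if i: "i \<in> {1..k}" for i
      using component_face_simple_roots[OF comp[OF i] ext[OF i]] slice[OF i] eq[OF i] by simp
    \<comment> \<open>The two vectors lie in \<open>span \<Phi>\<close> and agree on each root,
      since a root sees only the projection to its own component.\<close>
    have "v = (\<Sum>i\<in>{1..k}. w (\<Phi>i i))"
    proof (rule span_inner_eqI[OF facet_normalD(1)[OF v]])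
      show "(\<Sum>i\<in>{1..k}. w (\<Phi>i i)) \<in> span \<Phi>" using span_comp w(1) by (intro span_sum) blast
      fix \<beta> assume "\<beta> \<in> \<Phi>"
      then obtain j where j: "j \<in> {1..k}" "\<beta> \<in> \<Phi>i j" using root_ex by blast
      show "\<beta> \<bullet> v = \<beta> \<bullet> (\<Sum>i\<in>{1..k}. w (\<Phi>i i))"
        using sum_components_inner[OF assms(3) w(1) j] wb[OF j(2)] by simp
    qed
    also have "\<dots> = (\<Sum>i\<in>{1..k}. scaled_coweight \<Delta> (\<Phi>i i) (\<alpha> i))" by (rule sum.cong) (simp_all add: eq)
    finally have v_eq: "v = (\<Sum>i\<in>{1..k}. scaled_coweight \<Delta> (\<Phi>i i) (\<alpha> i))" .
    show "\<exists>\<alpha>. (\<forall>i\<in>{1..k}. extremal_root \<Delta> (\<Phi>i i) (\<alpha> i) \<and>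
                   face_simple_roots \<Phi> \<Delta> (\<Phi>i i) F = {\<alpha> i} \<and>
                   face_barycenter \<Phi> \<Delta> (\<Phi>i i) F = scaled_coweight \<Delta> (\<Phi>i i) (\<alpha> i)) \<and>
                (\<forall>H. supporting_hyperplane (span \<Phi>) ?P F H \<longleftrightarrow>
                   H = {x \<in> span \<Phi>. x \<bullet> (\<Sum>i\<in>{1..k}. scaled_coweight \<Delta> (\<Phi>i i) (\<alpha> i)) = 1})"
    proof (intro exI[of _ \<alpha>] conjI ballI allI)
      fix i assume i: "i \<in> {1..k}"
      show "extremal_root \<Delta> (\<Phi>i i) (\<alpha> i)" by (rule ext[OF i])
      show "face_simple_roots \<Phi> \<Delta> (\<Phi>i i) F = {\<alpha> i}" by (rule roots[OF i])
      then show "face_barycenter \<Phi> \<Delta> (\<Phi>i i) F = scaled_coweight \<Delta> (\<Phi>i i) (\<alpha> i)"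
        by (simp add: face_barycenter_def)
    next
      fix H
      show "supporting_hyperplane (span \<Phi>) ?P F H \<longleftrightarrow>
          H = {x \<in> span \<Phi>. x \<bullet> (\<Sum>i\<in>{1..k}. scaled_coweight \<Delta> (\<Phi>i i) (\<alpha> i)) = 1}"
        using supporting_hyperplane_iff[OF assms(1) v F] unfolding v_eq by blast
    qed
  next
    fix \<alpha> assume ext: "\<forall>i\<in>{1..k}. extremal_root \<Delta> (\<Phi>i i) (\<alpha> i)"
    define o' where "o' i = scaled_coweight \<Delta> (\<Phi>i i) (\<alpha> i)" for i
    define v where "v = (\<Sum>i\<in>{1..k}. o' i)"
    \<comment> \<open>\<open>facet_normal_components\<close> wants the normals indexed by the
      components themselves, so the numbering is inverted.\<close>
    define w where "w \<Psi> = o' (inv_into {1..k} \<Phi>i \<Psi>)" for \<Psi>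
    have w_eq: "w (\<Phi>i i) = o' i" if "i \<in> {1..k}" for i
      using assms(3) that by (simp add: w_def bij_betw_inv_into_left)
    have mem: "\<alpha> i \<in> \<Delta> \<inter> \<Phi>i i" if "i \<in> {1..k}" for i
      using ext that by (simp add: extremal_root_def)
    have o'_span: "o' i \<in> span (\<Phi>i i)" if "i \<in> {1..k}" for i
      using coweight_comp[OF that mem[OF that]] by (simp add: o'_def)
    have v_inner: "\<beta> \<bullet> v = \<beta> \<bullet> o' i" if "i \<in> {1..k}" "\<beta> \<in> \<Phi>i i" for \<beta> i
      unfolding v_def using sum_components_inner[OF assms(3) o'_span that] by simp
    have comp_normal: "facet_normal (\<Phi>i i) (o' i) \<and> (\<forall>\<gamma>\<in>\<Delta> \<inter> \<Phi>i i. \<gamma> \<bullet> o' i \<ge> 0)"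
      if i: "i \<in> {1..k}" for i
    proof -
      interpret C: irreducible_based_root_system "\<Phi>i i" "\<Delta> \<inter> \<Phi>i i"
        by (rule component_based[OF comp[OF i]])
      have "o' i = scaled_coweight (\<Delta> \<inter> \<Phi>i i) (\<Phi>i i) (\<alpha> i)"
        using component_scaled_coweight[OF comp[OF i] mem[OF i]] by (simp add: o'_def)
      moreover have "extremal_root (\<Delta> \<inter> \<Phi>i i) (\<Phi>i i) (\<alpha> i)"
        using ext i component_extremal_root by blast
      ultimately show ?thesis
        using C.facet_normal_if_extremal C.scaled_coweight_dominant[OF mem[OF i]] by metis
    qed
    have "v \<in> span \<Phi>" unfolding v_def using span_comp o'_span by (intro span_sum) blast
    then have "facet_normal \<Phi> v \<longleftrightarrow> (\<forall>\<Psi>\<in>irreducible_components \<Phi>. facet_normal \<Psi> (w \<Psi>))"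
    proof (rule facet_normal_components[OF assms(1)])
      fix \<Psi> assume "\<Psi> \<in> irreducible_components \<Phi>"
      then obtain i where i: "i \<in> {1..k}" "\<Psi> = \<Phi>i i" using comp_ex by blast
      then show "w \<Psi> \<in> span \<Psi>" using o'_span w_eq by simp
      show "\<beta> \<bullet> v = \<beta> \<bullet> w \<Psi>" if "\<beta> \<in> \<Psi>" for \<beta> using i that v_inner w_eq by simp
    qed
    then have v: "facet_normal \<Phi> v" using comp_ex comp_normal w_eq by metis
    have "\<forall>\<gamma>\<in>\<Delta>. \<gamma> \<bullet> v \<ge> 0"
    proof
      fix \<gamma> assume "\<gamma> \<in> \<Delta>"
      then obtain i where i: "i \<in> {1..k}" "\<gamma> \<in> \<Delta> \<inter> \<Phi>i i" using simple_ex by blast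
      then show "\<gamma> \<bullet> v \<ge> 0" using comp_normal[OF i(1)] v_inner[OF i(1), of \<gamma>] by simp
    qed
    then have "standard_facet ?P ?C (?P \<inter> {x. x \<bullet> v = 1})"
      using standard_face_iff_dominant[OF assms(1) simple_subset v refl] v
        facet_of_root_polytope_iff[OF assms(1)] by (auto simp: standard_facet_def)
    moreover have "supporting_hyperplane (span \<Phi>) ?P (?P \<inter> {x. x \<bullet> v = 1}) {x \<in> span \<Phi>. x \<bullet> v = 1}"
      using supporting_hyperplane_iff[OF assms(1) v refl] by blast
    ultimately show "\<exists>F. standard_facet ?P ?C F \<and> supporting_hyperplane (span \<Phi>) ?P F
        {x \<in> span \<Phi>. x \<bullet> (\<Sum>i\<in>{1..k}. scaled_coweight \<Delta> (\<Phi>i i) (\<alpha> i)) = 1}"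
      unfolding v_def o'_def by blast
  }
qed

end
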